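(* Let $n\ge2$, $N=2^n$ and $m\in\{2,\dots,n\}$. The singular value decomposition of $S^n_{(m)}$, up to the ordering of the singular values, is given by $$S^n_{(m)}=U^n_{(m)}\,\Sigma^n_{(m)}\,V^{n\top}_{(m)},$$ where $$U^n_{(m)}:=\mathrm{Id}_4\otimes(Q^n_mU^n_m),\qquad \Sigma^n_{(m)}:=\mathrm{Id}_4\otimes\Sigma^n_m,\qquad V^n_{(m)}:=\mathrm{Id}_4\otimes(P^{n\top}_mV^n_m).$$ The multiplication by each factor can be computed in at most $\mathcal{O}(N^2\log N)$ operations.
   Context: Notation. $[k]=\{0,1,\dots,k-1\}$; $\mathrm{Id}_k$ is the $k\times k$ identity; $\otimes$ is the Kronecker product; $N=2^n$; $\log$ is base 2; $\mathbb{R}^A$ is the space of real functions on a finite set $A$, and linear maps are identified with matrices; $a\,\%\,b$ is the remainder of $a$ modulo $b$. Single-quadrant level of the approximate discrete Radon transform (ADRT). Let $E^n_m=\{(h,s)\in\mathbb{Z}\times[2^n] : -(s\,\%\,2^m)\le h<2^n\}$. The map $S^n_m:\mathbb{R}^{E^n_{m-1}}\to\mathbb{R}^{E^n_m}$, $S^n_m[f]=g$, is defined, for $\ell\in[2^{n-m}]$ and $s\in[2^{m-1}]$, by $$g(h,\,\ell2^m+2s)=f(h,\,2\ell\,2^{m-1}+s)+f(h+s,\,(2\ell+1)2^{m-1}+s),$$ $$g(h,\,\ell2^m+2s+1)=f(h,\,2\ell\,2^{m-1}+s)+f(h+s+1,\,(2\ell+1)2^{m-1}+s),$$ for all $h$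 for which the left-hand index is in $E^n_m$, where $f$ is extended by $0$ outside $E^n_{m-1}$. Full ADRT level. For $m\ge2$, $S^n_{(m)}:=\mathrm{Id}_4\otimes S^n_m:\mathbb{R}^{4\times E^n_{m-1}}\to\mathbb{R}^{4\times E^n_m}$ (one copy of $S^n_m$ per quadrant). Blocks. For $t\ge1$, $H_t\in\mathbb{R}^{2t\times t}$ has $(H_t)_{2i,i}=(H_t)_{2i+1,i}=1$, $i\in[t]$, zeros elsewhere; $H_0$ is empty. For $k=1,\dots,t$: the $k$-th column of $U_t^+\in\mathbb{R}^{(t+1)\times t}$ has entries $\sin\left(\frac{k\pi(j+1/2)}{t+1}\right)$, $j\in[t+1]$; the $k$-th column of $V_t^+\in\mathbb{R}^{t\times t}$ has entries $\sin\left(\frac{k\pi(j+1)}{t+1}\right)$, $j\in[t]$; $\Sigma_t^+$ is diagonal with $k$-th entry $2\cos\left(\frac{k\pi}{2t+2}\right)$. For integers $r>s\ge0$, $$U_{r,s}=\mathrm{diag}[H_s,U^+_{2(r-s)},H_s],\quad \Sigma_{r,s}=\mathrm{diag}[\mathrm{Id}_s,\Sigma^+_{2(r-s)},\mathrm{Id}_s],\quad V_{r,s}=\mathrm{diag}[\mathrm{Id}_s,V^+_{2(r-s)},\mathrm{Id}_s].$$ Set $$U^n_m=\mathrm{Id}_{2^{n-m}}\otimes\mathrm{diag}[U_{N,0},U_{N+1,1},\dots,U_{N+2^{m-1}-1,\,2^{m-1}-1}],$$ and define $\Sigma^n_m$, $V^n_m$ in the same way from $\Sigma_{N+s,s}$,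 $V_{N+s,s}$, $s\in[2^{m-1}]$. The blocks are indexed by $(\ell,s)\in[2^{n-m}]\times[2^{m-1}]$ in lexicographic order. Alternating concatenation with shift. For $u,v\in\mathbb{R}^r$ and $t\in[r]$, $$[u\mid v]_t=(u_0,\dots,u_{t-1},\;u_t,v_0,u_{t+1},v_1,\dots,u_{r-1},v_{r-1-t},\;v_{r-t},\dots,v_{r-1})\in\mathbb{R}^{2r}.$$ Flattening permutation $P^n_m:\mathbb{R}^{E^n_{m-1}}\to\mathbb{R}^{|E^n_{m-1}|}$. The $(\ell,s)$ block of $P^n_m[f]$, of length $2(N+s)$, is $[u\mid v]_s$, where $u=(f(h,2\ell\,2^{m-1}+s))_{-s\le h<N}$ and $v=(f(h,(2\ell+1)2^{m-1}+s))_{-s\le h<N}$. Unflattening permutation $Q^n_m:\mathbb{R}^{|E^n_m|}\to\mathbb{R}^{E^n_m}$. It undoes the alternating concatenation with zero shift of consecutive columns: if $y$ is the $(\ell,s)$ block (of length $2N+4s+1$) of a vector, then $g=Q^n_m[\cdot]$ is determined by $[a\mid b]_0=y$ with $a=(g(h,\ell2^m+2s))_{-2s\le h<N}$ and $b=(g(h,\ell2^m+2s+1))_{-2s-1\le h<N}$, i.e. $y=(a_0,b_0,a_1,b_1,\dots,a_{N+2s-1},b_{N+2s-1},b_{N+2s})$.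
   Formalization: As printed the identity fails: columns of U^+_t, V^+_t need the factor sqrt(2/(t+1)); P must use [v|u]_s and Q must use [b|a]_0; since columns of H_t have length sqrt 2, the true SVD is obtained by normalizing the columns of U and moving their lengths into Sigma. *)

theory Defs
  imports Complex_Main "Jordan_Normal_Form.Matrix"
begin

text \<open>Real functions on a finite set \<open>A\<close> are represented by total functions vanishing outside
  \<open>A\<close>; \<open>restr0 A\<close> is restriction to \<open>A\<close> followed by extension by zero. The set \<open>4 \<times> A\<close> (four
  quadrants) enters only through Kronecker products with the identity of size 4.\<close>

definition fun_space :: "'a set \<Rightarrow> ('a \<Rightarrow> real) set" where
  "fun_space A = {f. \<forall>x. x \<notin> A \<longrightarrow> f x = 0}"

definition restr0 :: "'a set \<Rightarrow> ('a \<Rightarrow> real) \<Rightarrow> 'a \<Rightarrow> real" where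
  "restr0 A f = (\<lambda>x. if x \<in> A then f x else 0)"

definition E :: "nat \<Rightarrow> nat \<Rightarrow> (int \<times> nat) set" where
  "E n m = {(h, s). s < 2 ^ n \<and> - int (s mod 2 ^ m) \<le> h \<and> h < 2 ^ n}"

text \<open>A column index is \<open>c = l * 2^m + r\<close> with \<open>r < 2^m\<close>, and \<open>r = 2 * s\<close> or \<open>r = 2 * s + 1\<close>.\<close>

definition S_map :: "nat \<Rightarrow> nat \<Rightarrow> (int \<times> nat \<Rightarrow> real) \<Rightarrow> (int \<times> nat \<Rightarrow> real)" where
  "S_map n m f = restr0 (E n m) (\<lambda>(h, c).
     let F = restr0 (E n (m - 1)) f; l = c div 2 ^ m; r = c mod 2 ^ m; s = r div 2 in
       if even r
       then F (h, 2 * l * 2 ^ (m - 1) + s) + F (h + int s, (2 * l + 1) * 2 ^ (m - 1) + s)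
       else F (h, 2 * l * 2 ^ (m - 1) + s) + F (h + int s + 1, (2 * l + 1) * 2 ^ (m - 1) + s))"

text \<open>Alternating concatenation \<open>[u | v]\<^sub>t\<close>. Since \<open>splice\<close> appends what is left of the longer
  argument, the second list may be longer than what remains of the first, and for \<open>t = 0\<close> the lists
  may have different lengths.\<close>

definition altcat :: "nat \<Rightarrow> 'a list \<Rightarrow> 'a list \<Rightarrow> 'a list" where
  "altcat t u v = take t u @ splice (drop t u) v"

definition column :: "(int \<times> nat \<Rightarrow> real) \<Rightarrow> int \<Rightarrow> int \<Rightarrow> nat \<Rightarrow> real list" where
  "column f lo hi c = map (\<lambda>h. f (h, c)) [lo..hi - 1]"

definition block_indices :: "nat \<Rightarrow> nat \<Rightarrow> (nat \<times> nat) list" where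
  "block_indices n m = List.product [0..<2 ^ (n - m)] [0..<2 ^ (m - 1)]"

text \<open>The flattening of the input. For every output column pair the sums
  produced by \<open>S_map\<close> form, in the order of increasing height, a chain
  \<open>v\<^sub>s, v\<^sub>s + u\<^sub>0, u\<^sub>0 + v\<^sub>s\<^sub>+\<^sub>1, v\<^sub>s\<^sub>+\<^sub>1 + u\<^sub>1, \<dots>\<close>, so the odd column \<open>v\<close> has to come first in the alternating
  concatenation; likewise the odd column \<open>b\<close>, which is longer by one, comes first on the output side.
  With the opposite order the factorization is false.\<close>

definition P_map :: "nat \<Rightarrow> nat \<Rightarrow> (int \<times> nat \<Rightarrow> real) \<Rightarrow> real list" where
  "P_map n m f = concat (map (\<lambda>(l, s).
     let u = column f (- int s) (2 ^ n) (2 * l * 2 ^ (m - 1) + s);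
         v = column f (- int s) (2 ^ n) ((2 * l + 1) * 2 ^ (m - 1) + s)
     in altcat s v u) (block_indices n m))"

definition out_flat :: "nat \<Rightarrow> nat \<Rightarrow> (int \<times> nat \<Rightarrow> real) \<Rightarrow> real list" where
  "out_flat n m g = concat (map (\<lambda>(l, s).
     let a = column g (- 2 * int s) (2 ^ n) (l * 2 ^ m + 2 * s);
         b = column g (- 2 * int s - 1) (2 ^ n) (l * 2 ^ m + 2 * s + 1)
     in altcat 0 b a) (block_indices n m))"

definition Q_map :: "nat \<Rightarrow> nat \<Rightarrow> real list \<Rightarrow> (int \<times> nat \<Rightarrow> real)" where
  "Q_map n m = inv_into (fun_space (E n m)) (out_flat n m)"

text \<open>Matrices of these linear maps, with \<open>E n m\<close> enumerated column by column.\<close>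

definition E_list :: "nat \<Rightarrow> nat \<Rightarrow> (int \<times> nat) list" where
  "E_list n m = concat (map (\<lambda>s. map (\<lambda>h. (h, s)) [- int (s mod 2 ^ m)..2 ^ n - 1]) [0..<2 ^ n])"

definition ind :: "'a \<Rightarrow> 'a \<Rightarrow> real" where
  "ind a = (\<lambda>x. if x = a then 1 else 0)"

definition S_mat :: "nat \<Rightarrow> nat \<Rightarrow> real mat" where
  "S_mat n m = mat (card (E n m)) (card (E n (m - 1)))
     (\<lambda>(i, j). S_map n m (ind (E_list n (m - 1) ! j)) (E_list n m ! i))"

definition P_mat :: "nat \<Rightarrow> nat \<Rightarrow> real mat" where
  "P_mat n m = mat (card (E n (m - 1))) (card (E n (m - 1)))
     (\<lambda>(i, j). P_map n m (ind (E_list n (m - 1) ! j)) ! i)"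

definition Q_mat :: "nat \<Rightarrow> nat \<Rightarrow> real mat" where
  "Q_mat n m = mat (card (E n m)) (card (E n m))
     (\<lambda>(i, j). Q_map n m (list_of_vec (unit_vec (card (E n m)) j)) (E_list n m ! i))"

definition kron :: "real mat \<Rightarrow> real mat \<Rightarrow> real mat" where
  "kron A B = mat (dim_row A * dim_row B) (dim_col A * dim_col B)
     (\<lambda>(i, j). A $$ (i div dim_row B, j div dim_col B) * B $$ (i mod dim_row B, j mod dim_col B))"

definition H_blk :: "nat \<Rightarrow> real mat" where
  "H_blk t = mat (2 * t) t (\<lambda>(i, j). if i = 2 * j \<or> i = 2 * j + 1 then 1 else 0)"

text \<open>Column \<open>j\<close> (counted from 0) carries frequency \<open>k = j + 1\<close>. The factor \<open>sqrt (2 / (t + 1))\<close>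
  gives the sine vectors unit length; without it the product \<open>U \<Sigma> V\<^sup>T\<close> would be off by the
  factor \<open>(t + 1) / 2\<close>.\<close>

definition U_plus :: "nat \<Rightarrow> real mat" where
  "U_plus t = mat (t + 1) t
     (\<lambda>(i, j). sqrt (2 / (real t + 1)) * sin (real (j + 1) * pi * (real i + 1 / 2) / (real t + 1)))"

definition V_plus :: "nat \<Rightarrow> real mat" where
  "V_plus t = mat t t
     (\<lambda>(i, j). sqrt (2 / (real t + 1)) * sin (real (j + 1) * pi * (real i + 1) / (real t + 1)))"

definition Sigma_plus :: "nat \<Rightarrow> real mat" where
  "Sigma_plus t = mat t t
     (\<lambda>(i, j). if i = j then 2 * cos (real (j + 1) * pi / (2 * real t + 2)) else 0)"

definition U_blk :: "nat \<Rightarrow> nat \<Rightarrow> real mat" where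
  "U_blk r s = diag_block_mat [H_blk s, U_plus (2 * (r - s)), H_blk s]"

definition Sigma_blk :: "nat \<Rightarrow> nat \<Rightarrow> real mat" where
  "Sigma_blk r s = diag_block_mat [1\<^sub>m s, Sigma_plus (2 * (r - s)), 1\<^sub>m s]"

definition V_blk :: "nat \<Rightarrow> nat \<Rightarrow> real mat" where
  "V_blk r s = diag_block_mat [1\<^sub>m s, V_plus (2 * (r - s)), 1\<^sub>m s]"

definition level_diag :: "(nat \<Rightarrow> nat \<Rightarrow> real mat) \<Rightarrow> nat \<Rightarrow> nat \<Rightarrow> real mat" where
  "level_diag B n m =
     kron (1\<^sub>m (2 ^ (n - m))) (diag_block_mat (map (\<lambda>s. B (2 ^ n + s) s) [0..<2 ^ (m - 1)]))"

definition S_full :: "nat \<Rightarrow> nat \<Rightarrow> real mat" where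
  "S_full n m = kron (1\<^sub>m 4) (S_mat n m)"

definition U_full :: "nat \<Rightarrow> nat \<Rightarrow> real mat" where
  "U_full n m = kron (1\<^sub>m 4) (Q_mat n m * level_diag U_blk n m)"

definition Sigma_full :: "nat \<Rightarrow> nat \<Rightarrow> real mat" where
  "Sigma_full n m = kron (1\<^sub>m 4) (level_diag Sigma_blk n m)"

definition V_full :: "nat \<Rightarrow> nat \<Rightarrow> real mat" where
  "V_full n m = kron (1\<^sub>m 4) (transpose_mat (P_mat n m) * level_diag V_blk n m)"

text \<open>Reduced singular value decomposition, the singular values being in any order.\<close>

definition is_svd :: "real mat \<Rightarrow> real mat \<Rightarrow> real mat \<Rightarrow> real mat \<Rightarrow> bool" where
  "is_svd A U S V \<longleftrightarrow> (let k = min (dim_row A) (dim_col A) in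
     U \<in> carrier_mat (dim_row A) k \<and> S \<in> carrier_mat k k \<and> V \<in> carrier_mat (dim_col A) k \<and>
     transpose_mat U * U = 1\<^sub>m k \<and> transpose_mat V * V = 1\<^sub>m k \<and>
     diagonal_mat S \<and> (\<forall>i<k. 0 \<le> S $$ (i, i)) \<and>
     A = U * S * transpose_mat V)"

text \<open>The columns of \<open>H_blk t\<close> have length \<open>sqrt 2\<close>, so \<open>U_full\<close> has orthogonal columns that are not
  all of unit length. Normalizing them moves the lengths into the diagonal factor.\<close>

definition col_norm :: "real mat \<Rightarrow> nat \<Rightarrow> real" where
  "col_norm A j = sqrt (col A j \<bullet> col A j)"

definition col_norms :: "real mat \<Rightarrow> real mat" where
  "col_norms A = mat (dim_col A) (dim_col A) (\<lambda>(i, j). if i = j then col_norm A j else 0)"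

definition normalize_cols :: "real mat \<Rightarrow> real mat" where
  "normalize_cols A = mat (dim_row A) (dim_col A) (\<lambda>(i, j). A $$ (i, j) / col_norm A j)"

text \<open>Operation count: the length of a straight-line program over the reals. The input vector is the
  initial memory, each instruction appends one cell computed from earlier cells (cells that do not
  exist read as 0), and the result has to occupy the last cells in the right order; hence rearranging
  data is charged as well (\<open>Scale 1 i\<close> copies cell \<open>i\<close>). The constants in \<open>Scale\<close> are free.\<close>

datatype instr = Add nat nat | Sub nat nat | Scale real nat

definition cell :: "real list \<Rightarrow> nat \<Rightarrow> real" where
  "cell mem i = (if i < length mem then mem ! i else 0)"

fun exec :: "instr \<Rightarrow> real list \<Rightarrow> real list" where
  "exec (Add i j) mem = mem @ [cell mem i + cell mem j]"
| "exec (Sub i j) mem = mem @ [cell mem i - cell mem j]"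
| "exec (Scale c i) mem = mem @ [c * cell mem i]"

definition computes :: "instr list \<Rightarrow> real mat \<Rightarrow> bool" where
  "computes p A \<longleftrightarrow> (\<forall>x \<in> carrier_vec (dim_col A).
     let mem = fold exec p (list_of_vec x) in
       dim_row A \<le> length mem \<and>
       drop (length mem - dim_row A) mem = list_of_vec (A *\<^sub>v x))"

end

theory Submission
  imports Defs
begin

text \<open>
  Why the factorization holds. A pair of output columns \<open>a\<close>, \<open>b\<close> of one level depends on a single pair
  of input columns \<open>u\<close>, \<open>v\<close>. Counting each column from its lowest height, \<open>b\<^sub>i = v\<^sub>i + u\<^sub>i\<^sub>-\<^sub>s\<^sub>-\<^sub>1\<close> and
  \<open>a\<^sub>i = v\<^sub>i + u\<^sub>i\<^sub>-\<^sub>s\<close>, where entries outside a column are zero. If the outputs are listed as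
  \<open>b\<^sub>0, a\<^sub>0, b\<^sub>1, a\<^sub>1, \<dots>\<close> and the inputs as \<open>v\<^sub>0, \<dots>, v\<^sub>s\<^sub>-\<^sub>1\<close>, then alternately \<open>v\<^sub>s, u\<^sub>0, v\<^sub>s\<^sub>+\<^sub>1, u\<^sub>1, \<dots>\<close>,
  then the rest of \<open>u\<close>, then the first \<open>s\<close> and the last \<open>s\<close> inputs are each copied to two
  outputs, and in between every output is the sum of two neighbouring inputs. So the block is
  \<open>diag[H, bidiagonal, H]\<close> (\<open>block_is_diag\<close>), and different blocks do not interact
  (\<open>S_kernel_support\<close>).

  The singular vectors of the bidiagonal matrix are sines: the product-to-sum formula
  \<open>2 sin(x + y) cos y = sin(x + 2y) + sin x\<close> turns \<open>U \<Sigma> V\<^sup>T\<close> into a sum of two Gram matrices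
  of sine vectors, and discrete orthogonality evaluates these (\<open>bidiag_svd\<close>). The flattening maps
  are permutations, hence orthogonal, and Kronecker products with an identity only repeat blocks.
  The columns of \<open>H\<close> are orthogonal with length \<open>sqrt 2\<close>; dividing the columns by their lengths gives
  the decomposition with orthonormal factors (\<open>svd_from_orthogonal_columns\<close>).

  Why the factors are cheap. Only the sine transforms cost more than linear time in the number of
  entries; there are \<open>N / 2\<close> of them in each of the four quadrants. Their angles are multiples of \<open>\<pi> / (2N + 1)\<close>
  or half of it, and \<open>2N + 1\<close> is odd, so repeated halving of the transform itself is not available. However, \<open>2xy = x\<^sup>2 + y\<^sup>2 - (x - y)\<^sup>2\<close> writes
  the transform as diagonal times Toeplitz times diagonal with complex entries (Bluestein's chirp
  transform, \<open>mat_chain_chirp\<close>), and a Toeplitz matrix of any size is a corner of a circulant matrix of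
  size a power of two (\<open>toeplitz_chain\<close>). A circulant product is a multiplication modulo \<open>x\<^sup>K - c\<close>.
  From \<open>x\<^sup>2\<^sup>K - d\<^sup>2 = (x\<^sup>K - d)(x\<^sup>K + d)\<close> one such product of length \<open>2K\<close> reduces to two of length \<open>K\<close>
  and \<open>O(K)\<close> further operations, which gives \<open>O(K log K)\<close> (\<open>twisted_circulant_chain\<close>).

  Costs are counted without memory addresses. A computation is regarded as the growth of a set of
  available functions of the input, each step adding one linear combination of two available functions
  (\<open>lin_chain\<close>). Such chains compose, combine in parallel and can be transported along substitutions;
  they are turned into straight-line programs once, at the end (\<open>mat_chain_computes\<close>).
\<close>

section \<open>Sine bases and the bidiagonal matrix\<close>

text \<open>Multiplying by \<open>2 sin(x/2)\<close> makes the sum telescope.\<close>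

lemma sum_cos_midpoints: "2 * sin (x / 2) * (\<Sum>i<n. cos (x * (real i + 1 / 2))) = sin (real n * x)"
proof -
  have "2 * sin (x / 2) * cos (x * (real i + 1 / 2)) = sin (real (Suc i) * x) - sin (real i * x)" for i
    by (simp add: sin_diff_sin algebra_simps add_divide_distrib)
  then have "2 * sin (x / 2) * (\<Sum>i<n. cos (x * (real i + 1 / 2)))
      = (\<Sum>i<n. sin (real (Suc i) * x) - sin (real i * x))"
    by (simp only: sum_distrib_left)
  also have "\<dots> = sin (real n * x)"
    using sum_lessThan_telescope[of "\<lambda>i. sin (real i * x)" n] by simp
  finally show ?thesis .
qed

lemma sum_cos_integers: "2 * sin (x / 2) * (\<Sum>i<n. cos (x * (real i + 1))) = sin (real n * x + x / 2) - sin (x / 2)"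
proof -
  have "2 * sin (x / 2) * cos (x * (real i + 1)) = sin (real (Suc i) * x + x / 2) - sin (real i * x + x / 2)" for i
    by (simp add: sin_diff_sin algebra_simps add_divide_distrib)
  then have "2 * sin (x / 2) * (\<Sum>i<n. cos (x * (real i + 1)))
      = (\<Sum>i<n. sin (real (Suc i) * x + x / 2) - sin (real i * x + x / 2))"
    by (simp only: sum_distrib_left)
  also have "\<dots> = sin (real n * x + x / 2) - sin (x / 2)"
    using sum_lessThan_telescope[of "\<lambda>i. sin (real i * x + x / 2)" n] by simp
  finally show ?thesis .
qed

text \<open>The factor \<open>2 sin(x/2)\<close> that makes the cosine sums telescope has to be cancelled
  afterwards.\<close>

lemma sin_half_angle_neq_0:
  fixes p :: int
  assumes "p \<noteq> 0" "\<bar>p\<bar> < 2 * (int t + 1)"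
  shows "sin (of_int p * pi / (real t + 1) / 2) \<noteq> 0"
proof
  assume "sin (of_int p * pi / (real t + 1) / 2) = 0"
  then obtain i :: int where "of_int p * pi / (real t + 1) / 2 = of_int i * pi"
    unfolding sin_zero_iff_int2 by blast
  then have "of_int p * pi = of_int i * (2 * (real t + 1)) * pi" by (simp add: field_simps)
  then have "of_int p = (of_int i * (2 * (real t + 1)) :: real)" by simp
  then have "p = i * (2 * (int t + 1))"
    by (metis (mono_tags, opaque_lifting) of_int_1 of_int_add of_int_eq_iff of_int_mult of_int_numeral of_int_of_nat_eq)
  then show False using assms by (cases "i = 0") (auto simp: abs_mult mult_less_cancel_right1)
qed

lemma sum_cos_midpoints_0:
  fixes p :: int
  assumes "p \<noteq> 0" "\<bar>p\<bar> < 2 * (int t + 1)"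
  shows "(\<Sum>i<t + 1. cos (of_int p * pi / (real t + 1) * (real i + 1 / 2))) = 0"
proof -
  have "real (t + 1) * (of_int p * pi / (real t + 1)) = of_int p * pi" by (simp add: field_simps)
  then have "sin (real (t + 1) * (of_int p * pi / (real t + 1))) = 0"
    by (simp add: sin_zero_iff_int2)
  then show ?thesis
    using sum_cos_midpoints[of "of_int p * pi / (real t + 1)" "t + 1"] sin_half_angle_neq_0[OF assms] by simp
qed

text \<open>The value depends on \<open>p\<close> only through its parity; hence the sums for \<open>p = a - b\<close> and
  \<open>p = a + b\<close> agree, which gives the orthogonality of the sine vectors.\<close>

lemma sum_cos_integers_parity:
  fixes p :: int
  assumes "p \<noteq> 0" "\<bar>p\<bar> < 2 * (int t + 1)"
  shows "(\<Sum>i<t. cos (of_int p * pi / (real t + 1) * (real i + 1))) = - (1 + cos (of_int p * pi)) / 2"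
proof -
  define x where "x = of_int p * pi / (real t + 1)"
  have "real t + 1 \<noteq> 0" by linarith
  then have "(real t + 1) * x = of_int p * pi" by (simp add: x_def)
  then have "real t * x + x = of_int p * pi" by (simp add: distrib_right)
  then have angle: "real t * x + x / 2 = of_int p * pi - x / 2" by linarith
  have "sin (of_int p * pi) = 0" by (simp add: sin_zero_iff_int2)
  then have "2 * sin (x / 2) * (\<Sum>i<t. cos (x * (real i + 1))) = - (1 + cos (of_int p * pi)) * sin (x / 2)"
    unfolding sum_cos_integers angle sin_diff by (simp add: left_diff_distrib)
  then have "sin (x / 2) * (2 * (\<Sum>i<t. cos (x * (real i + 1))) + (1 + cos (of_int p * pi))) = 0"
    by (simp only: distrib_left mult_ac) simp
  moreover have "sin (x / 2) \<noteq> 0" unfolding x_def by (rule sin_half_angle_neq_0[OF assms])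
  ultimately have "2 * (\<Sum>i<t. cos (x * (real i + 1))) + (1 + cos (of_int p * pi)) = 0"
    using mult_eq_0_iff by blast
  moreover have "S = - c / 2" if "2 * S + c = 0" for S c :: real using that by simp
  ultimately show ?thesis unfolding x_def by blast
qed

text \<open>The index \<open>a\<close> is allowed to be \<open>0\<close> or \<open>t + 1\<close>, where the sine vector vanishes: these
  values occur at the two ends of the bidiagonal matrix.\<close>

lemma sine_orthogonality:
  assumes "a \<le> t + 1" "0 < b" "b \<le> t"
  shows "(\<Sum>k<t. sin (real (k + 1) * pi * real a / (real t + 1)) * sin (real (k + 1) * pi * real b / (real t + 1)))
     = (if a = b then (real t + 1) / 2 else 0)"
proof -
  let ?x = "\<lambda>p :: int. of_int p * pi / (real t + 1)"
  let ?C = "\<lambda>p. \<Sum>k<t. cos (?x p * (real k + 1))"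
  have "(\<Sum>k<t. sin (real (k + 1) * pi * real a / (real t + 1)) * sin (real (k + 1) * pi * real b / (real t + 1)))
     = (\<Sum>k<t. (cos (?x (int a - int b) * (real k + 1)) - cos (?x (int a + int b) * (real k + 1))) / 2)"
    by (intro sum.cong refl) (simp add: sin_times_sin algebra_simps diff_divide_distrib add_divide_distrib)
  also have "\<dots> = (?C (int a - int b) - ?C (int a + int b)) / 2"
    by (simp add: sum_subtractf flip: sum_divide_distrib)
  also have "?C (int a + int b) = - (1 + cos (of_int (int a + int b) * pi)) / 2"
    using assms by (intro sum_cos_integers_parity) auto
  also have "cos (of_int (int a + int b) * pi) = cos (of_int (int a - int b) * pi)"
  proof -
    have "of_int (int a + int b) * pi = of_int (int a - int b) * pi + 2 * real b * pi" by (simp add: algebra_simps)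
    then show ?thesis by (simp only: cos_add cos_2npi sin_2npi mult_1_right mult_zero_right diff_zero)
  qed
  also have "(?C (int a - int b) - - (1 + cos (of_int (int a - int b) * pi)) / 2) / 2 = (if a = b then (real t + 1) / 2 else 0)"
  proof (cases "a = b")
    case False
    then have "?C (int a - int b) = - (1 + cos (of_int (int a - int b) * pi)) / 2"
      using assms by (intro sum_cos_integers_parity) auto
    with False show ?thesis by simp
  qed simp
  finally show ?thesis .
qed

lemma midpoint_sine_orthogonality:
  assumes "0 < a" "a \<le> t" "0 < b" "b \<le> t"
  shows "(\<Sum>i<t + 1. sin (real a * pi * (real i + 1 / 2) / (real t + 1)) * sin (real b * pi * (real i + 1 / 2) / (real t + 1)))
     = (if a = b then (real t + 1) / 2 else 0)"
proof -
  let ?x = "\<lambda>p :: int. of_int p * pi / (real t + 1)"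
  let ?C = "\<lambda>p. \<Sum>i<t + 1. cos (?x p * (real i + 1 / 2))"
  have "(\<Sum>i<t + 1. sin (real a * pi * (real i + 1 / 2) / (real t + 1)) * sin (real b * pi * (real i + 1 / 2) / (real t + 1)))
     = (\<Sum>i<t + 1. (cos (?x (int a - int b) * (real i + 1 / 2)) - cos (?x (int a + int b) * (real i + 1 / 2))) / 2)"
    by (intro sum.cong refl) (simp add: sin_times_sin algebra_simps diff_divide_distrib add_divide_distrib)
  also have "\<dots> = (?C (int a - int b) - ?C (int a + int b)) / 2"
    by (simp only: sum_subtractf flip: sum_divide_distrib)
  also have "?C (int a + int b) = 0"
    using assms by (intro sum_cos_midpoints_0) auto
  also have "(?C (int a - int b) - 0) / 2 = (if a = b then (real t + 1) / 2 else 0)"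
  proof (cases "a = b")
    case False
    then have "?C (int a - int b) = 0" using assms by (intro sum_cos_midpoints_0) auto
    with False show ?thesis by simp
  qed simp
  finally show ?thesis .
qed

lemma V_plus_symmetric: "transpose_mat (V_plus t) = V_plus t"
  by (rule eq_matI) (simp_all add: V_plus_def mult.commute mult.left_commute add.commute)

lemma sqrt_norm_square: "sqrt (2 / (real t + 1)) * sqrt (2 / (real t + 1)) = 2 / (real t + 1)"
  by simp

lemma V_plus_orthogonal: "transpose_mat (V_plus t) * V_plus t = 1\<^sub>m t"
proof (rule eq_matI)
  fix i j assume "i < dim_row (1\<^sub>m t :: real mat)" "j < dim_col (1\<^sub>m t :: real mat)"
  then have ij: "i < t" "j < t" by auto
  let ?s = "\<lambda>a k. sin (real (k + 1) * pi * real a / (real t + 1))"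
  have V: "V_plus t $$ (i, k) = sqrt (2 / (real t + 1)) * ?s (i + 1) k" if "i < t" "k < t" for i k
    using that by (simp add: V_plus_def add.commute)
  have "transpose_mat (V_plus t) * V_plus t = V_plus t * transpose_mat (V_plus t)"
    by (simp only: V_plus_symmetric)
  then have "(transpose_mat (V_plus t) * V_plus t) $$ (i, j) = (\<Sum>k<t. V_plus t $$ (i, k) * V_plus t $$ (j, k))"
    using ij by (auto simp: V_plus_def scalar_prod_def lessThan_atLeast0 intro!: sum.cong)
  also have "\<dots> = (\<Sum>k<t. (sqrt (2 / (real t + 1)) * sqrt (2 / (real t + 1))) * (?s (i + 1) k * ?s (j + 1) k))"
    by (intro sum.cong refl) (use ij in \<open>simp only: V lessThan_iff mult_ac\<close>)
  also have "\<dots> = 2 / (real t + 1) * (\<Sum>k<t. ?s (i + 1) k * ?s (j + 1) k)"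
    by (simp only: sqrt_norm_square sum_distrib_left)
  also have "\<dots> = 1\<^sub>m t $$ (i, j)"
    using ij by (subst sine_orthogonality) (auto simp: field_simps)
  finally show "(transpose_mat (V_plus t) * V_plus t) $$ (i, j) = 1\<^sub>m t $$ (i, j)" .
qed (simp_all add: V_plus_def)

lemma U_plus_orthogonal: "transpose_mat (U_plus t) * U_plus t = 1\<^sub>m t"
proof (rule eq_matI)
  fix i j assume "i < dim_row (1\<^sub>m t :: real mat)" "j < dim_col (1\<^sub>m t :: real mat)"
  then have ij: "i < t" "j < t" by auto
  let ?s = "\<lambda>a k. sin (real a * pi * (real k + 1 / 2) / (real t + 1))"
  have U: "U_plus t $$ (k, i) = sqrt (2 / (real t + 1)) * ?s (i + 1) k" if "i < t" "k < t + 1" for i k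
    using that by (simp add: U_plus_def)
  have "(transpose_mat (U_plus t) * U_plus t) $$ (i, j) = (\<Sum>k<t + 1. U_plus t $$ (k, i) * U_plus t $$ (k, j))"
    using ij by (auto simp: U_plus_def scalar_prod_def lessThan_atLeast0 simp del: sum.op_ivl_Suc intro!: sum.cong)
  also have "\<dots> = (\<Sum>k<t + 1. (sqrt (2 / (real t + 1)) * sqrt (2 / (real t + 1))) * (?s (i + 1) k * ?s (j + 1) k))"
    by (intro sum.cong refl) (use ij in \<open>simp only: U lessThan_iff mult_ac\<close>)
  also have "\<dots> = 2 / (real t + 1) * (\<Sum>k<t + 1. ?s (i + 1) k * ?s (j + 1) k)"
    by (simp only: sqrt_norm_square sum_distrib_left)
  also have "\<dots> = 1\<^sub>m t $$ (i, j)"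
    using ij by (subst midpoint_sine_orthogonality) (auto simp: field_simps)
  finally show "(transpose_mat (U_plus t) * U_plus t) $$ (i, j) = 1\<^sub>m t $$ (i, j)" .
qed (simp_all add: U_plus_def)

definition bidiag :: "nat \<Rightarrow> real mat" where
  "bidiag t = mat (t + 1) t (\<lambda>(i, j). if i = j \<or> i = j + 1 then 1 else 0)"

lemma mult_diagonal_index:
  fixes A :: "'a::semiring_0 mat"
  assumes "D \<in> carrier_mat n n" "diagonal_mat D" "dim_col A = n" "i < dim_row A" "j < n"
  shows "(A * D) $$ (i, j) = A $$ (i, j) * D $$ (j, j)"
proof -
  have "(A * D) $$ (i, j) = (\<Sum>k<n. A $$ (i, k) * D $$ (k, j))"
    using assms by (auto simp: scalar_prod_def lessThan_atLeast0 intro!: sum.cong)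
  also have "\<dots> = (\<Sum>k<n. if k = j then A $$ (i, k) * D $$ (k, j) else 0)"
    using assms by (intro sum.cong) (auto simp: diagonal_mat_def)
  also have "\<dots> = A $$ (i, j) * D $$ (j, j)" using assms by simp
  finally show ?thesis .
qed

text \<open>Each row of \<open>U \<Sigma>\<close> is, by the product-to-sum formula, the sum of the two sine vectors with the
  neighbouring frequencies \<open>i\<close> and \<open>i + 1\<close>, and the rows of \<open>V\<close> are orthonormal sine vectors.\<close>

lemma bidiag_svd: "U_plus t * Sigma_plus t * transpose_mat (V_plus t) = bidiag t"
proof (rule eq_matI)
  fix i j assume "i < dim_row (bidiag t)" "j < dim_col (bidiag t)"
  then have ij: "i < t + 1" "j < t" by (auto simp: bidiag_def)
  let ?s = "\<lambda>a k. sin (real (k + 1) * pi * real a / (real t + 1))"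
  have Sig: "Sigma_plus t \<in> carrier_mat t t" "diagonal_mat (Sigma_plus t)"
    by (auto simp: Sigma_plus_def diagonal_mat_def)
  have "(U_plus t * Sigma_plus t * transpose_mat (V_plus t)) $$ (i, j)
      = (\<Sum>k<t. (U_plus t * Sigma_plus t) $$ (i, k) * V_plus t $$ (j, k))"
    using ij by (auto simp: U_plus_def Sigma_plus_def V_plus_def scalar_prod_def lessThan_atLeast0 intro!: sum.cong)
  also have "\<dots> = (\<Sum>k<t. 2 / (real t + 1) * (?s (i + 1) k * ?s (j + 1) k + ?s i k * ?s (j + 1) k))"
  proof (intro sum.cong refl)
    fix k assume k: "k \<in> {..<t}"
    define y where "y = real (k + 1) * pi / (real t + 1)"
    have y: "real (k + 1) * pi * z / (real t + 1) = y * z" for z by (simp add: y_def)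
    have y2: "real (k + 1) * pi / (2 * real t + 2) = y / 2" by (simp add: y_def field_simps)
    note y' = y[unfolded Suc_eq_plus1[symmetric]] y2[unfolded Suc_eq_plus1[symmetric]]
    have "(U_plus t * Sigma_plus t) $$ (i, k) = U_plus t $$ (i, k) * Sigma_plus t $$ (k, k)"
      by (rule mult_diagonal_index[OF Sig]) (use ij k in \<open>auto simp: U_plus_def\<close>)
    also have "\<dots> = sqrt (2 / (real t + 1)) * (2 * (sin (y * (real i + 1 / 2)) * cos (y / 2)))"
      using ij k by (simp add: U_plus_def Sigma_plus_def y' del: of_nat_add of_nat_Suc)
    also have "2 * (sin (y * (real i + 1 / 2)) * cos (y / 2)) = sin (y * (real i + 1)) + sin (y * real i)"
    proof -
      have "y * (real i + 1 / 2) + y / 2 = y * (real i + 1)" "y * (real i + 1 / 2) - y / 2 = y * real i"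
        by (simp_all add: algebra_simps)
      then show ?thesis by (simp only: sin_times_cos) simp
    qed
    finally have "(U_plus t * Sigma_plus t) $$ (i, k) = sqrt (2 / (real t + 1)) * (?s (i + 1) k + ?s i k)"
      unfolding y by (simp add: add.commute)
    moreover have "V_plus t $$ (j, k) = sqrt (2 / (real t + 1)) * ?s (j + 1) k"
      using ij k by (simp add: V_plus_def add.commute)
    ultimately have "(U_plus t * Sigma_plus t) $$ (i, k) * V_plus t $$ (j, k)
        = sqrt (2 / (real t + 1)) * sqrt (2 / (real t + 1)) * ((?s (i + 1) k + ?s i k) * ?s (j + 1) k)"
      by (simp only: mult_ac)
    then show "(U_plus t * Sigma_plus t) $$ (i, k) * V_plus t $$ (j, k)
        = 2 / (real t + 1) * (?s (i + 1) k * ?s (j + 1) k + ?s i k * ?s (j + 1) k)"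
      by (simp only: sqrt_norm_square distrib_right)
  qed
  also have "\<dots> = 2 / (real t + 1) * ((\<Sum>k<t. ?s (i + 1) k * ?s (j + 1) k) + (\<Sum>k<t. ?s i k * ?s (j + 1) k))"
    by (simp only: sum_distrib_left sum.distrib[symmetric])
  also have "\<dots> = bidiag t $$ (i, j)"
    using ij by (subst (1 2) sine_orthogonality) (auto simp: bidiag_def field_simps)
  finally show "(U_plus t * Sigma_plus t * transpose_mat (V_plus t)) $$ (i, j) = bidiag t $$ (i, j)" .
qed (simp_all add: U_plus_def V_plus_def bidiag_def)

section \<open>Block diagonal matrices\<close>

lemma four_block_diag_mult:
  fixes A1 :: "'a::semiring_0 mat"
  assumes A: "A1 \<in> carrier_mat nr1 n1" "A2 \<in> carrier_mat n1 nc1"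
    and D: "D1 \<in> carrier_mat nr2 n2" "D2 \<in> carrier_mat n2 nc2"
  shows "four_block_mat A1 (0\<^sub>m nr1 n2) (0\<^sub>m nr2 n1) D1 * four_block_mat A2 (0\<^sub>m n1 nc2) (0\<^sub>m n2 nc1) D2
    = four_block_mat (A1 * A2) (0\<^sub>m nr1 nc2) (0\<^sub>m nr2 nc1) (D1 * D2)"
  unfolding mult_four_block_mat[OF A(1) zero_carrier_mat zero_carrier_mat D(1) A(2) zero_carrier_mat zero_carrier_mat D(2)]
  by (rule cong_four_block_mat) (use A D in auto)

lemma diag_block_mat_mult:
  fixes A B :: "'i \<Rightarrow> 'a::semiring_0 mat"
  assumes "\<And>p. p \<in> set ps \<Longrightarrow> dim_col (A p) = dim_row (B p)"
  shows "diag_block_mat (map A ps) * diag_block_mat (map B ps) = diag_block_mat (map (\<lambda>p. A p * B p) ps)"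
  using assms
proof (induction ps)
  case (Cons p ps)
  let ?A = "diag_block_mat (map A ps)" and ?B = "diag_block_mat (map B ps)"
  have IH: "?A * ?B = diag_block_mat (map (\<lambda>p. A p * B p) ps)" using Cons by simp
  have Ap: "dim_col (A p) = dim_row (B p)" using Cons.prems by simp
  have "map dim_col (map A ps) = map dim_row (map B ps)" using Cons.prems by simp
  then have dim: "dim_col ?A = dim_row ?B" by (simp only: dim_diag_block_mat)
  show ?case
    unfolding list.map diag_block_mat.simps Let_def IH[symmetric] index_mult_mat(2,3) Ap dim
    by (rule four_block_diag_mult[OF carrier_matI[OF refl Ap] carrier_matI[OF refl refl]
          carrier_matI[OF refl dim] carrier_matI[OF refl refl]])
qed simp

lemma diag_block_mat_transpose:
  "transpose_mat (diag_block_mat (map A ps)) = diag_block_mat (map (\<lambda>p. transpose_mat (A p)) ps)"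
proof (induction ps)
  case Nil
  show ?case by (rule eq_matI) auto
next
  case (Cons p ps)
  let ?A = "diag_block_mat (map A ps)"
  show ?case
    unfolding list.map diag_block_mat.simps Let_def Cons.IH[symmetric]
    using transpose_four_block_mat[OF carrier_matI[OF refl refl] zero_carrier_mat zero_carrier_mat
        carrier_matI[OF refl refl], of "A p" ?A] by simp
qed

lemma diag_block_mat_one: "diag_block_mat (map (\<lambda>p. 1\<^sub>m (d p)) ps) = 1\<^sub>m (\<Sum>p\<leftarrow>ps. d p)"
  using diag_block_one_mat[of "map (\<lambda>p. 1\<^sub>m (d p)) ps"] by (simp add: o_def)

lemma diag_block_mat_concat: "diag_block_mat (concat Ass) = diag_block_mat (map diag_block_mat Ass)"
  by (induction Ass) (simp_all add: diag_block_mat_append Let_def)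

lemma kron_one: "kron (1\<^sub>m k) A = diag_block_mat (replicate k A)"
proof (induction k)
  case 0
  show ?case by (rule eq_matI) (auto simp: kron_def)
next
  case (Suc k)
  have "kron (1\<^sub>m (Suc k)) A = four_block_mat A (0\<^sub>m (dim_row A) (dim_col (kron (1\<^sub>m k) A)))
      (0\<^sub>m (dim_row (kron (1\<^sub>m k) A)) (dim_col A)) (kron (1\<^sub>m k) A)" (is "?L = ?R")
  proof (rule eq_matI)
    fix i j assume "i < dim_row ?R" "j < dim_col ?R"
    then have i: "i < dim_row A + k * dim_row A" and j: "j < dim_col A + k * dim_col A"
      by (auto simp: kron_def)
    then have pos: "0 < dim_row A" "0 < dim_col A" by (auto intro: gr0I)
    have div_lt: "i div dim_row A < Suc k" "j div dim_col A < Suc k"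
      using i j pos by (simp_all add: less_mult_imp_div_less)
    have i': "i - dim_row A < k * dim_row A" if "\<not> i < dim_row A" using i that by simp
    have j': "j - dim_col A < k * dim_col A" if "\<not> j < dim_col A" using j that by simp
    have div': "(i - dim_row A) div dim_row A < k" if "\<not> i < dim_row A"
      using i'[OF that] by (simp add: less_mult_imp_div_less)
    have div'': "(j - dim_col A) div dim_col A < k" if "\<not> j < dim_col A"
      using j'[OF that] by (simp add: less_mult_imp_div_less)
    have "?L $$ (i, j) = (if i div dim_row A = j div dim_col A then A $$ (i mod dim_row A, j mod dim_col A) else 0)"
      using i j div_lt by (simp add: kron_def)
    also have "\<dots> = ?R $$ (i, j)"
    proof (cases "i < dim_row A"; cases "j < dim_col A")
      assume "i < dim_row A" "j < dim_col A"
      then show ?thesis by simp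
    next
      assume "i < dim_row A" and nj: "\<not> j < dim_col A"
      then show ?thesis using j j' pos by (simp add: kron_def le_div_geq)
    next
      assume ni: "\<not> i < dim_row A" and "j < dim_col A"
      then show ?thesis using i i' pos by (simp add: kron_def le_div_geq)
    next
      assume ni: "\<not> i < dim_row A" and nj: "\<not> j < dim_col A"
      then have "i div dim_row A = Suc ((i - dim_row A) div dim_row A)" "i mod dim_row A = (i - dim_row A) mod dim_row A"
        "j div dim_col A = Suc ((j - dim_col A) div dim_col A)" "j mod dim_col A = (j - dim_col A) mod dim_col A"
        using pos by (simp_all add: le_div_geq le_mod_geq)
      then show ?thesis using i j ni nj i'[OF ni] j'[OF nj] div'[OF ni] div''[OF nj] by (simp add: kron_def)
    qed
    finally show "?L $$ (i, j) = ?R $$ (i, j)" .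
  qed (auto simp: kron_def)
  then show ?case by (simp add: Suc.IH Let_def)
qed

text \<open>The order of the blocks is the one in which the flattening maps list the columns.\<close>

lemma level_diag_blocks:
  "level_diag B n m = diag_block_mat (map (\<lambda>(l, s). B (2 ^ n + s) s) (block_indices n m))"
proof -
  have "map (\<lambda>(l, s). B (2 ^ n + s) s) (block_indices n m)
      = concat (replicate (2 ^ (n - m)) (map (\<lambda>s. B (2 ^ n + s) s) [0..<2 ^ (m - 1)]))"
    by (simp add: block_indices_def List.product_concat_map map_concat o_def map_replicate_const)
  then show ?thesis
    by (simp add: level_diag_def kron_one diag_block_mat_concat)
qed

text \<open>The instances are positive entries, for Gram matrices, and nonnegative entries, for singular
  values.\<close>

definition diag_with :: "(real \<Rightarrow> bool) \<Rightarrow> real mat \<Rightarrow> bool" where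
  "diag_with P D \<longleftrightarrow> dim_row D = dim_col D \<and> diagonal_mat D \<and> (\<forall>i<dim_row D. P (D $$ (i, i)))"

lemma diag_with_one: "P 1 \<Longrightarrow> diag_with P (1\<^sub>m n)"
  by (auto simp: diag_with_def diagonal_mat_def)

lemma diag_with_diag_block: "(\<And>D. D \<in> set Ds \<Longrightarrow> diag_with P D) \<Longrightarrow> diag_with P (diag_block_mat Ds)"
proof (induction Ds)
  case Nil
  then show ?case by (simp add: diag_with_def diagonal_mat_def)
next
  case (Cons D Ds)
  then have "diag_with P D" "diag_with P (diag_block_mat Ds)" by auto
  then show ?case by (auto simp: diag_with_def diagonal_mat_def Let_def)
qed

section \<open>Matrices of kernels between lists\<close>

text \<open>Reordering the rows or columns of such a matrix is a change of the lists, with the kernel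
  unchanged.\<close>

definition kernel_mat :: "('y \<Rightarrow> 'x \<Rightarrow> real) \<Rightarrow> 'y list \<Rightarrow> 'x list \<Rightarrow> real mat" where
  "kernel_mat K ys xs = mat (length ys) (length xs) (\<lambda>(i, j). K (ys ! i) (xs ! j))"

text \<open>For lists without repetitions and with the same elements this is a permutation matrix.\<close>

abbreviation match_mat :: "'a list \<Rightarrow> 'a list \<Rightarrow> real mat" where
  "match_mat \<equiv> kernel_mat (\<lambda>x y. of_bool (x = y))"

lemma kernel_mat_carrier [simp]: "kernel_mat K ys xs \<in> carrier_mat (length ys) (length xs)"
  by (simp add: kernel_mat_def)

lemma kernel_mat_dim [simp]: "dim_row (kernel_mat K ys xs) = length ys" "dim_col (kernel_mat K ys xs) = length xs"
  by (simp_all add: kernel_mat_def)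

lemma transpose_match_mat: "transpose_mat (match_mat ys xs) = match_mat xs ys"
  by (rule eq_matI) (auto simp: kernel_mat_def)

lemma kernel_mat_append:
  "kernel_mat K (ys @ ys') (xs @ xs') = four_block_mat (kernel_mat K ys xs) (kernel_mat K ys xs') (kernel_mat K ys' xs) (kernel_mat K ys' xs')"
  by (rule eq_matI) (auto simp: kernel_mat_def nth_append)

lemma kernel_mat_zero:
  assumes "\<And>y x. y \<in> set ys \<Longrightarrow> x \<in> set xs \<Longrightarrow> K y x = 0"
  shows "kernel_mat K ys xs = 0\<^sub>m (length ys) (length xs)"
  by (rule eq_matI) (use assms in \<open>auto simp: kernel_mat_def\<close>)

lemma kernel_mat_concat:
  assumes "distinct ps"
    and "\<And>p q y x. p \<in> set ps \<Longrightarrow> q \<in> set ps \<Longrightarrow> p \<noteq> q \<Longrightarrow> y \<in> set (Y p) \<Longrightarrow> x \<in> set (X q) \<Longrightarrow> K y x = 0"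
  shows "kernel_mat K (concat (map Y ps)) (concat (map X ps)) = diag_block_mat (map (\<lambda>p. kernel_mat K (Y p) (X p)) ps)"
  using assms
proof (induction ps)
  case Nil
  show ?case by (rule eq_matI) (auto simp: kernel_mat_def)
next
  case (Cons p ps)
  have IH: "kernel_mat K (concat (map Y ps)) (concat (map X ps)) = diag_block_mat (map (\<lambda>p. kernel_mat K (Y p) (X p)) ps)"
    using Cons.prems(1) by (intro Cons.IH Cons.prems(2)) auto
  have row: "kernel_mat K (Y p) (concat (map X ps)) = 0\<^sub>m (length (Y p)) (length (concat (map X ps)))"
  proof (rule kernel_mat_zero)
    fix y x assume "y \<in> set (Y p)" "x \<in> set (concat (map X ps))"
    then obtain q where "q \<in> set ps" "x \<in> set (X q)" "y \<in> set (Y p)" by auto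
    then show "K y x = 0" using Cons.prems(1) by (intro Cons.prems(2)[of p q]) auto
  qed
  have col: "kernel_mat K (concat (map Y ps)) (X p) = 0\<^sub>m (length (concat (map Y ps))) (length (X p))"
  proof (rule kernel_mat_zero)
    fix y x assume "y \<in> set (concat (map Y ps))" "x \<in> set (X p)"
    then obtain q where "q \<in> set ps" "y \<in> set (Y q)" "x \<in> set (X p)" by auto
    then show "K y x = 0" using Cons.prems(1) by (intro Cons.prems(2)[of q p]) auto
  qed
  show ?case
    unfolding list.map concat.simps kernel_mat_append row col diag_block_mat.simps Let_def IH[symmetric] kernel_mat_dim ..
qed

lemma match_mat_mult:
  assumes "distinct ys" "set us \<subseteq> set ys"
  shows "match_mat us ys * kernel_mat K ys xs = kernel_mat K us xs"
proof (rule eq_matI)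
  fix i j assume "i < dim_row (kernel_mat K us xs)" "j < dim_col (kernel_mat K us xs)"
  then have ij: "i < length us" "j < length xs" by simp_all
  then obtain k where k: "k < length ys" "ys ! k = us ! i"
    using assms(2) by (metis in_set_conv_nth subsetD)
  have uniq: "us ! i = ys ! l \<longleftrightarrow> l = k" if "l < length ys" for l
    using k assms(1) that by (auto simp: nth_eq_iff_index_eq simp flip: k(2))
  have "(match_mat us ys * kernel_mat K ys xs) $$ (i, j)
      = (\<Sum>l<length ys. of_bool (us ! i = ys ! l) * K (ys ! l) (xs ! j))"
    using ij by (auto simp: kernel_mat_def scalar_prod_def lessThan_atLeast0 intro!: sum.cong)
  also have "\<dots> = (\<Sum>l<length ys. if l = k then K (ys ! l) (xs ! j) else 0)"
    by (intro sum.cong) (auto simp: uniq)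
  also have "\<dots> = kernel_mat K us xs $$ (i, j)" using k ij by (simp add: kernel_mat_def)
  finally show "(match_mat us ys * kernel_mat K ys xs) $$ (i, j) = kernel_mat K us xs $$ (i, j)" .
qed simp_all

lemma kernel_mat_mult_eq:
  assumes "distinct xs" "set us \<subseteq> set xs"
  shows "kernel_mat K ys xs * match_mat xs us = kernel_mat K ys us"
proof -
  have "transpose_mat (match_mat us xs * kernel_mat (\<lambda>x y. K y x) xs ys) = transpose_mat (kernel_mat (\<lambda>x y. K y x) us ys)"
    using assms by (simp add: match_mat_mult)
  moreover have tr: "transpose_mat (kernel_mat (\<lambda>x y. K y x) zs ys) = kernel_mat K ys zs" for zs
    by (rule eq_matI) (auto simp: kernel_mat_def)
  ultimately show ?thesis
    by (subst (asm) transpose_mult[of _ "length us" "length xs" _ "length ys"]) (simp_all add: tr transpose_match_mat)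
qed

lemma match_mat_self: "distinct xs \<Longrightarrow> match_mat xs xs = 1\<^sub>m (length xs)"
  by (rule eq_matI) (auto simp: kernel_mat_def nth_eq_iff_index_eq)

section \<open>The level map in the interleaved orders\<close>

lemma map_splice: "map f (splice xs ys) = splice (map f xs) (map f ys)"
  by (induction xs ys rule: splice.induct) auto

lemma map_altcat: "map f (altcat t xs ys) = altcat t (map f xs) (map f ys)"
  by (simp add: altcat_def map_splice take_map drop_map)

lemma set_splice: "set (splice xs ys) = set xs \<union> set ys"
  using set_shuffles[OF splice_in_shuffles] .

lemma set_altcat: "set (altcat t xs ys) = set xs \<union> set ys"
proof -
  have "set (altcat t xs ys) = set (take t xs @ drop t xs) \<union> set ys"
    unfolding altcat_def set_append set_splice by blast
  then show ?thesis by simp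
qed

lemma distinct_altcat:
  assumes "distinct xs" "distinct ys" "set xs \<inter> set ys = {}"
  shows "distinct (altcat t xs ys)"
proof -
  have "distinct (take t xs @ drop t xs)" using assms(1) by simp
  then have "distinct (take t xs)" "distinct (drop t xs)" "set (take t xs) \<inter> set (drop t xs) = {}"
    unfolding distinct_append by auto
  moreover have "distinct (splice (drop t xs) ys)"
    using assms by (intro distinct_disjoint_shuffles[OF _ _ _ splice_in_shuffles]) (auto dest: in_set_dropD)
  ultimately show ?thesis
    using assms(3) unfolding altcat_def distinct_append set_splice by (auto dest: in_set_takeD)
qed

lemma distinct_concat_map:
  assumes "distinct ps" "\<And>p. p \<in> set ps \<Longrightarrow> distinct (X p)"
    and "\<And>p q. p \<in> set ps \<Longrightarrow> q \<in> set ps \<Longrightarrow> p \<noteq> q \<Longrightarrow> set (X p) \<inter> set (X q) = {}"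
  shows "distinct (concat (map X ps))"
  using assms
proof (induction ps)
  case (Cons p ps)
  have "distinct (concat (map X ps))" using Cons.prems by (intro Cons.IH) auto
  moreover have "set (X p) \<inter> set (concat (map X ps)) = {}"
    using Cons.prems(1) Cons.prems(3)[of p] by auto
  ultimately show ?case using Cons.prems by simp
qed simp

definition strip :: "int \<Rightarrow> int \<Rightarrow> nat \<Rightarrow> (int \<times> nat) list" where
  "strip lo hi c = map (\<lambda>h. (h, c)) [lo..hi - 1]"

lemma column_eq: "column f lo hi c = map f (strip lo hi c)"
  by (simp add: column_def strip_def)

lemma set_strip: "set (strip lo hi c) = {(h, c') . c' = c \<and> lo \<le> h \<and> h < hi}"
  by (auto simp: strip_def)

lemma distinct_strip: "distinct (strip lo hi c)"
  by (simp add: strip_def distinct_map inj_on_def)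

text \<open>The lists \<open>in_order\<close> and \<open>out_order\<close> are the orders in which the two flattening maps read
  the coordinates; flattening a function is mapping it over such a list.\<close>

definition in_block :: "nat \<Rightarrow> nat \<Rightarrow> nat \<times> nat \<Rightarrow> (int \<times> nat) list" where
  "in_block n m = (\<lambda>(l, s). altcat s (strip (- int s) (2 ^ n) ((2 * l + 1) * 2 ^ (m - 1) + s))
     (strip (- int s) (2 ^ n) (2 * l * 2 ^ (m - 1) + s)))"

definition out_block :: "nat \<Rightarrow> nat \<Rightarrow> nat \<times> nat \<Rightarrow> (int \<times> nat) list" where
  "out_block n m = (\<lambda>(l, s). altcat 0 (strip (- 2 * int s - 1) (2 ^ n) (l * 2 ^ m + 2 * s + 1))
     (strip (- 2 * int s) (2 ^ n) (l * 2 ^ m + 2 * s)))"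

definition in_order :: "nat \<Rightarrow> nat \<Rightarrow> (int \<times> nat) list" where
  "in_order n m = concat (map (in_block n m) (block_indices n m))"

definition out_order :: "nat \<Rightarrow> nat \<Rightarrow> (int \<times> nat) list" where
  "out_order n m = concat (map (out_block n m) (block_indices n m))"

lemma P_map_in_order: "P_map n m f = map f (in_order n m)"
  by (simp add: P_map_def in_order_def in_block_def column_eq map_altcat map_concat Let_def case_prod_unfold o_def)

lemma out_flat_out_order: "out_flat n m g = map g (out_order n m)"
  by (simp add: out_flat_def out_order_def out_block_def column_eq map_altcat map_concat Let_def case_prod_unfold o_def)

lemma E_list_strips: "E_list n m = concat (map (\<lambda>c. strip (- int (c mod 2 ^ m)) (2 ^ n) c) [0..<2 ^ n])"
  by (simp add: E_list_def strip_def)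

lemma distinct_E_list: "distinct (E_list n m)"
  unfolding E_list_strips by (rule distinct_concat_map) (auto simp: distinct_strip set_strip)

lemma set_E_list: "set (E_list n m) = E n m"
  by (auto simp: E_list_strips set_strip E_def)

lemma length_E_list: "length (E_list n m) = card (E n m)"
  using distinct_card[OF distinct_E_list, of n m] by (simp add: set_E_list)

lemma block_indices_iff: "(l, s) \<in> set (block_indices n m) \<longleftrightarrow> l < 2 ^ (n - m) \<and> s < 2 ^ (m - 1)"
  by (auto simp: block_indices_def)

lemma distinct_block_indices: "distinct (block_indices n m)"
  by (simp add: block_indices_def distinct_product)

lemma div_mod_block:
  fixes l s M :: nat
  assumes "s < M"
  shows "(l * M + s) div M = l" "(l * M + s) mod M = s"
  using assms by simp_all

lemma div_2_cases: "a div 2 = b \<Longrightarrow> a = 2 * b \<or> a = 2 * b + 1" for a b :: nat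
  by presburger

definition S_kernel :: "nat \<Rightarrow> nat \<Rightarrow> int \<times> nat \<Rightarrow> int \<times> nat \<Rightarrow> real" where
  "S_kernel n m y x = S_map n m (ind x) y"

text \<open>The kernel does not refer to an enumeration of the index sets, so the level map can be studied
  in the interleaved orders instead of the column by column order.\<close>

lemma S_mat_eq: "S_mat n m = kernel_mat (S_kernel n m) (E_list n m) (E_list n (m - 1))"
  by (rule eq_matI) (auto simp: S_mat_def kernel_mat_def S_kernel_def length_E_list)

context
  fixes n m :: nat
  assumes m: "0 < m" "m \<le> n"
begin

lemma pow_m: "(2::nat) ^ m = 2 * 2 ^ (m - 1)"
  using m by (cases m) auto

lemma pow_n: "(2::nat) ^ n = 2 ^ (n - m) * 2 ^ m"
  using m by (simp flip: power_add)

text \<open>A column index determines its block: \<open>s\<close> is the remainder modulo \<open>2^(m-1)\<close> and \<open>l\<close> the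
  quotient by \<open>2^m\<close>. So the blocks partition the input coordinates; the next lemma does the same
  for the output coordinates.\<close>

lemma in_block_mem:
  assumes "s < 2 ^ (m - 1)"
  shows "(h, c) \<in> set (in_block n m (l, s)) \<longleftrightarrow>
    c mod 2 ^ (m - 1) = s \<and> c div 2 ^ m = l \<and> - int s \<le> h \<and> h < 2 ^ n"
proof -
  let ?M = "2 ^ (m - 1) :: nat"
  have "c = (2 * l + 1) * ?M + s \<or> c = 2 * l * ?M + s \<longleftrightarrow> c mod ?M = s \<and> c div ?M div 2 = l"
  proof
    assume "c = (2 * l + 1) * ?M + s \<or> c = 2 * l * ?M + s"
    then show "c mod ?M = s \<and> c div ?M div 2 = l"
      using assms by (elim disjE) (simp_all only: div_mod_block[OF assms], simp_all)
  next
    assume *: "c mod ?M = s \<and> c div ?M div 2 = l"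
    then have "c div ?M = 2 * l \<or> c div ?M = 2 * l + 1" using div_2_cases by blast
    moreover have "c = c div ?M * ?M + s" using * by (metis div_mult_mod_eq)
    ultimately show "c = (2 * l + 1) * ?M + s \<or> c = 2 * l * ?M + s" by metis
  qed
  moreover have "c div ?M div 2 = c div 2 ^ m"
    by (simp only: pow_m mult.commute[of 2 ?M] div_mult2_eq)
  ultimately show ?thesis by (auto simp: in_block_def set_altcat set_strip)
qed

lemma out_block_mem:
  assumes "s < 2 ^ (m - 1)"
  shows "(h, c) \<in> set (out_block n m (l, s)) \<longleftrightarrow>
    c mod 2 ^ m div 2 = s \<and> c div 2 ^ m = l \<and> - int (c mod 2 ^ m) \<le> h \<and> h < 2 ^ n"
proof -
  let ?M = "2 ^ m :: nat"
  have lt: "2 * s + 1 < ?M" "2 * s < ?M" using assms by (simp_all add: pow_m)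
  have odd: "(l * ?M + (2 * s + 1)) mod ?M = 2 * s + 1" "(l * ?M + (2 * s + 1)) div ?M = l"
    and even: "(l * ?M + 2 * s) mod ?M = 2 * s" "(l * ?M + 2 * s) div ?M = l"
    using lt by (simp_all only: div_mod_block)
  have iff: "c = l * ?M + (2 * s + 1) \<or> c = l * ?M + 2 * s \<longleftrightarrow> c mod ?M div 2 = s \<and> c div ?M = l"
  proof
    assume *: "c mod ?M div 2 = s \<and> c div ?M = l"
    then have "c mod ?M = 2 * s \<or> c mod ?M = 2 * s + 1" using div_2_cases by blast
    moreover have "c = l * ?M + c mod ?M" using * by (metis div_mult_mod_eq)
    ultimately show "c = l * ?M + (2 * s + 1) \<or> c = l * ?M + 2 * s" by metis
  qed (use odd even in auto)
  have "(h, c) \<in> set (out_block n m (l, s)) \<longleftrightarrow>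
      (c = l * ?M + (2 * s + 1) \<or> c = l * ?M + 2 * s) \<and> - int (c mod ?M) \<le> h \<and> h < 2 ^ n"
    using odd even by (auto simp: out_block_def set_altcat set_strip simp del: mult_Suc_right)
  then show ?thesis using iff by blast
qed

lemma div_block_less: "c < 2 ^ n \<longleftrightarrow> c div 2 ^ m < 2 ^ (n - m)" for c :: nat
  by (simp add: pow_n div_less_iff_less_mult)

lemma set_in_order: "set (in_order n m) = E n (m - 1)"
proof (rule Set.set_eqI)
  fix x :: "int \<times> nat"
  obtain h c where x: "x = (h, c)" by fastforce
  have "x \<in> set (in_order n m) \<longleftrightarrow> (\<exists>l s. l < 2 ^ (n - m) \<and> s < 2 ^ (m - 1) \<and> (h, c) \<in> set (in_block n m (l, s)))"
    by (auto simp: in_order_def x block_indices_iff) blast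
  also have "\<dots> \<longleftrightarrow> (\<exists>l s. l < 2 ^ (n - m) \<and> s < 2 ^ (m - 1) \<and>
      c mod 2 ^ (m - 1) = s \<and> c div 2 ^ m = l \<and> - int s \<le> h \<and> h < 2 ^ n)"
    using in_block_mem by blast
  also have "\<dots> \<longleftrightarrow> x \<in> E n (m - 1)"
    by (auto simp: x E_def div_block_less)
  finally show "x \<in> set (in_order n m) \<longleftrightarrow> x \<in> E n (m - 1)" .
qed

lemma set_out_order: "set (out_order n m) = E n m"
proof (rule Set.set_eqI)
  fix x :: "int \<times> nat"
  obtain h c where x: "x = (h, c)" by fastforce
  have "c mod 2 ^ m div 2 < 2 ^ (m - 1)"
    using pow_m by (simp add: div_less_iff_less_mult mult.commute)
  moreover have "x \<in> set (out_order n m) \<longleftrightarrow> (\<exists>l s. l < 2 ^ (n - m) \<and> s < 2 ^ (m - 1) \<and> (h, c) \<in> set (out_block n m (l, s)))"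
    by (auto simp: out_order_def x block_indices_iff) blast
  ultimately show "x \<in> set (out_order n m) \<longleftrightarrow> x \<in> E n m"
    by (auto simp: out_block_mem x E_def div_block_less)
qed

lemma distinct_in_order: "distinct (in_order n m)"
  unfolding in_order_def
proof (rule distinct_concat_map[OF distinct_block_indices])
  fix p
  show "distinct (in_block n m p)"
    by (cases p) (auto simp: in_block_def set_strip intro!: distinct_altcat distinct_strip)
next
  fix p q assume "p \<in> set (block_indices n m)" "q \<in> set (block_indices n m)" "p \<noteq> q"
  moreover obtain l s l' s' where "p = (l, s)" "q = (l', s')" by fastforce
  ultimately show "set (in_block n m p) \<inter> set (in_block n m q) = {}"
    by (auto simp: block_indices_iff in_block_mem)
qed

lemma distinct_out_order: "distinct (out_order n m)"
  unfolding out_order_def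
proof (rule distinct_concat_map[OF distinct_block_indices])
  fix p
  show "distinct (out_block n m p)"
    by (cases p) (auto simp: out_block_def set_strip intro!: distinct_altcat distinct_strip)
next
  fix p q assume "p \<in> set (block_indices n m)" "q \<in> set (block_indices n m)" "p \<noteq> q"
  moreover obtain l s l' s' where "p = (l, s)" "q = (l', s')" by fastforce
  ultimately show "set (out_block n m p) \<inter> set (out_block n m q) = {}"
    by (auto simp: block_indices_iff out_block_mem)
qed

lemma length_in_order: "length (in_order n m) = card (E n (m - 1))"
  using distinct_card[OF distinct_in_order] by (simp add: set_in_order)

lemma length_out_order: "length (out_order n m) = card (E n m)"
  using distinct_card[OF distinct_out_order] by (simp add: set_out_order)

lemma P_mat_eq: "P_mat n m = match_mat (in_order n m) (E_list n (m - 1))"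
  by (rule eq_matI) (auto simp: P_mat_def kernel_mat_def P_map_in_order ind_def length_in_order length_E_list)

text \<open>The inverse of mapping over a list without repetitions sends unit vectors to indicators.\<close>

lemma Q_map_unit:
  assumes "j < length (out_order n m)"
  shows "Q_map n m (list_of_vec (unit_vec (length (out_order n m)) j)) = ind (out_order n m ! j)"
  unfolding Q_map_def
proof (rule inv_into_f_eq)
  show "inj_on (out_flat n m) (fun_space (E n m))"
  proof (rule inj_onI, rule ext)
    fix f g x assume fg: "f \<in> fun_space (E n m)" "g \<in> fun_space (E n m)" "out_flat n m f = out_flat n m g"
    then have "\<forall>x\<in>E n m. f x = g x" by (simp add: out_flat_out_order set_out_order)
    then show "f x = g x" using fg(1,2)
      by (cases "x \<in> E n m") (simp_all add: fun_space_def del: split_paired_All)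
  qed
  have "out_order n m ! j \<in> E n m" using assms nth_mem set_out_order by blast
  then show "ind (out_order n m ! j) \<in> fun_space (E n m)" by (auto simp: fun_space_def ind_def)
  show "out_flat n m (ind (out_order n m ! j)) = list_of_vec (unit_vec (length (out_order n m)) j)"
    using assms distinct_out_order
    by (auto intro!: nth_equalityI simp: out_flat_out_order ind_def list_of_vec_index unit_vec_def nth_eq_iff_index_eq)
qed

lemma Q_mat_eq: "Q_mat n m = match_mat (E_list n m) (out_order n m)"
  by (rule eq_matI) (auto simp: Q_mat_def kernel_mat_def ind_def length_E_list Q_map_unit simp flip: length_out_order)

lemma S_kernel_even:
  assumes "s < 2 ^ (m - 1)" "(h, l * 2 ^ m + 2 * s) \<in> E n m" "x \<in> E n (m - 1)"
  shows "S_kernel n m (h, l * 2 ^ m + 2 * s) x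
    = of_bool (x = (h, 2 * l * 2 ^ (m - 1) + s)) + of_bool (x = (h + int s, (2 * l + 1) * 2 ^ (m - 1) + s))"
proof -
  have lt: "2 * s < 2 ^ m" using assms(1) by (simp add: pow_m)
  have "restr0 (E n (m - 1)) (ind x) = ind x" using assms(3) by (auto simp: restr0_def ind_def)
  then show ?thesis using assms(2) div_mod_block[OF lt, of l]
    by (auto simp: S_kernel_def S_map_def restr0_def[of "E n m"] ind_def Let_def simp del: mod_mult_self3 mod_mult_self4)
qed

lemma S_kernel_odd:
  assumes "s < 2 ^ (m - 1)" "(h, l * 2 ^ m + 2 * s + 1) \<in> E n m" "x \<in> E n (m - 1)"
  shows "S_kernel n m (h, l * 2 ^ m + 2 * s + 1) x
    = of_bool (x = (h, 2 * l * 2 ^ (m - 1) + s)) + of_bool (x = (h + int s + 1, (2 * l + 1) * 2 ^ (m - 1) + s))"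
proof -
  have lt: "2 * s + 1 < 2 ^ m" using assms(1) by (simp add: pow_m)
  have "restr0 (E n (m - 1)) (ind x) = ind x" using assms(3) by (auto simp: restr0_def ind_def)
  then show ?thesis using assms(2) div_mod_block[OF lt, of l]
    by (auto simp: S_kernel_def S_map_def restr0_def[of "E n m"] ind_def Let_def add.assoc)
qed

end

lemma splice_append:
  "length xs = length ys \<Longrightarrow> splice (xs @ xs') (ys @ ys') = splice xs ys @ splice xs' ys'"
  by (induction xs ys rule: list_induct2) auto

lemma splice_map_upt:
  "splice (map f [0..<k]) (map g [0..<k]) = map (\<lambda>i. if even i then f (i div 2) else g (i div 2)) [0..<2 * k]"
  by (induction k) (simp_all add: splice_append)

lemma strip_upt: "strip lo hi c = map (\<lambda>i. (lo + int i, c)) [0..<nat (hi - lo)]"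
  by (rule nth_equalityI) (simp_all add: strip_def nth_upto)

lemma kernel_mat_diag3:
  assumes "\<And>y x. y \<in> set Y0 \<Longrightarrow> x \<in> set X1 \<union> set X2 \<Longrightarrow> K y x = 0"
    and "\<And>y x. y \<in> set Y1 \<Longrightarrow> x \<in> set X0 \<union> set X2 \<Longrightarrow> K y x = 0"
    and "\<And>y x. y \<in> set Y2 \<Longrightarrow> x \<in> set X0 \<union> set X1 \<Longrightarrow> K y x = 0"
  shows "kernel_mat K (Y0 @ Y1 @ Y2) (X0 @ X1 @ X2) = diag_block_mat [kernel_mat K Y0 X0, kernel_mat K Y1 X1, kernel_mat K Y2 X2]"
proof -
  have "kernel_mat K (concat (map ((!) [Y0, Y1, Y2]) [0, 1, 2])) (concat (map ((!) [X0, X1, X2]) [0, 1, 2]))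
      = diag_block_mat (map (\<lambda>p. kernel_mat K ([Y0, Y1, Y2] ! p) ([X0, X1, X2] ! p)) [0, 1, 2])"
    by (rule kernel_mat_concat) (use assms in \<open>auto simp: numeral_2_eq_2\<close>)
  then show ?thesis by (simp add: numeral_2_eq_2)
qed

lemma kernel_mat_map_upt:
  "kernel_mat K (map y [a..<b]) (map x [c..<d]) = mat (b - a) (d - c) (\<lambda>(i, j). K (y (a + i)) (x (c + j)))"
  by (rule eq_matI) (simp_all add: kernel_mat_def del: upt_Suc)

text \<open>The positions in the lists are rewritten as explicit functions \<open>z\<close> (outputs) and \<open>v\<close>, \<open>w\<close>, \<open>u\<close> (inputs:
  unpaired beginning, interleaved middle, unpaired end), in which the kernel becomes a
  condition on \<open>k div 2\<close> and \<open>(k + 1) div 2\<close>.\<close>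

lemma block_is_diag:
  assumes m: "0 < m" "m \<le> n" and ls: "l < 2 ^ (n - m)" "s < 2 ^ (m - 1)"
  shows "kernel_mat (S_kernel n m) (out_block n m (l, s)) (in_block n m (l, s))
     = diag_block_mat [H_blk s, bidiag (2 * 2 ^ n), H_blk s]"
proof -
  define N :: nat where "N = 2 ^ n"
  define u v where "u i = (int i - int s, 2 * l * 2 ^ (m - 1) + s)"
    and "v i = (int i - int s, (2 * l + 1) * 2 ^ (m - 1) + s)" for i
  define a b where "a i = (int i - 2 * int s, l * 2 ^ m + 2 * s)"
    and "b i = (int i - 2 * int s - 1, l * 2 ^ m + 2 * s + 1)" for i
  define w where "w k = (if even k then v (s + k div 2) else u (k div 2))" for k
  define z where "z k = (if even k then b (k div 2) else a (k div 2))" for k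
  let ?K = "S_kernel n m"
  have N: "int N = 2 ^ n" by (simp add: N_def)
  have su: "strip (- int s) (2 ^ n) (2 * l * 2 ^ (m - 1) + s) = map u [0..<N + s]"
    and sv: "strip (- int s) (2 ^ n) ((2 * l + 1) * 2 ^ (m - 1) + s) = map v [0..<N + s]"
    and sa: "strip (- 2 * int s) (2 ^ n) (l * 2 ^ m + 2 * s) = map a [0..<N + 2 * s]"
    and sb: "strip (- 2 * int s - 1) (2 ^ n) (l * 2 ^ m + 2 * s + 1) = map b [0..<N + 2 * s + 1]"
    unfolding strip_upt u_def v_def a_def b_def N[symmetric]
    by (intro arg_cong2[of _ _ _ _ map] ext arg_cong2[of _ _ _ _ upt]; simp)+
  have inb: "in_block n m (l, s) = map v [0..<s] @ map w [0..<2 * N] @ map u [N..<N + s]"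
  proof -
    have vs: "drop s (map v [0..<N + s]) = map (\<lambda>i. v (s + i)) [0..<N]"
      by (rule nth_equalityI) simp_all
    have us: "map u [0..<N + s] = map u [0..<N] @ map u [N..<N + s]"
      by (simp flip: map_append upt_add_eq_append[of 0, simplified])
    have ts: "take s (map v [0..<N + s]) = map v [0..<s]" by (simp add: take_map)
    have "splice (map (\<lambda>i. v (s + i)) [0..<N] @ []) (map u [0..<N] @ map u [N..<N + s])
        = map w [0..<2 * N] @ map u [N..<N + s]"
      unfolding w_def by (subst splice_append) (simp_all only: splice_map_upt length_map length_upt splice.simps)
    then show ?thesis unfolding in_block_def altcat_def prod.case su sv vs ts us by simp
  qed
  have outz: "out_block n m (l, s) = map z [0..<2 * s + (2 * N + 1) + 2 * s]"
  proof -
    have "out_block n m (l, s) = splice (map b [0..<N + 2 * s] @ [b (N + 2 * s)]) (map a [0..<N + 2 * s] @ [])"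
      unfolding out_block_def altcat_def prod.case sa sb by simp
    also have "\<dots> = map z [0..<2 * (N + 2 * s)] @ [b (N + 2 * s)]"
      unfolding z_def by (subst splice_append) (simp_all add: splice_map_upt)
    also have "b (N + 2 * s) = z (2 * (N + 2 * s))" by (simp add: z_def)
    also have "map z [0..<2 * (N + 2 * s)] @ [z (2 * (N + 2 * s))] = map z [0..<2 * s + (2 * N + 1) + 2 * s]"
    proof -
      have "2 * s + (2 * N + 1) + 2 * s = Suc (2 * (N + 2 * s))" by simp
      then show ?thesis by (simp only: upt_Suc_append le0 map_append list.map)
    qed
    finally show ?thesis .
  qed
  have outb: "out_block n m (l, s) = map z [0..<2 * s] @ map z [2 * s..<2 * s + (2 * N + 1)]
      @ map z [2 * s + (2 * N + 1)..<2 * s + (2 * N + 1) + 2 * s]"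
    unfolding outz
    by (simp only: map_append[symmetric] upt_add_eq_append[OF le0, symmetric] append_assoc[symmetric])
  have memo: "z k \<in> E n m" if "k < 2 * s + (2 * N + 1) + 2 * s" for k
  proof -
    have "z k \<in> set (out_block n m (l, s))" unfolding outz set_map by (rule imageI) (use that in \<open>simp only: set_upt atLeastLessThan_iff le0 simp_thms\<close>)
    then show ?thesis using ls set_out_order[OF m] by (force simp: out_order_def block_indices_iff)
  qed
  have vu_mem: "v j \<in> E n (m - 1)" "u j \<in> E n (m - 1)" if "j < N + s" for j
  proof -
    have "v j \<in> set (in_block n m (l, s))" "u j \<in> set (in_block n m (l, s))"
      unfolding in_block_def prod.case set_altcat su sv using that by auto
    then show "v j \<in> E n (m - 1)" "u j \<in> E n (m - 1)"
      using ls set_in_order[OF m] by (force simp: in_order_def block_indices_iff)+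
  qed
  have Kv: "?K (z k) (v j) = of_bool (k div 2 = j)" if "k < 2 * s + (2 * N + 1) + 2 * s" "j < N + s" for k j
  proof (cases "even k")
    case True
    with memo[OF that(1)] have "b (k div 2) \<in> E n m" by (simp add: z_def)
    from S_kernel_odd[OF m ls(2) this[unfolded b_def] vu_mem(1)[OF that(2)]] True show ?thesis
      by (auto simp: z_def b_def v_def)
  next
    case False
    with memo[OF that(1)] have "a (k div 2) \<in> E n m" by (simp add: z_def)
    from S_kernel_even[OF m ls(2) this[unfolded a_def] vu_mem(1)[OF that(2)]] False show ?thesis
      by (auto simp: z_def a_def v_def)
  qed
  have Ku: "?K (z k) (u j) = of_bool ((k + 1) div 2 = j + s + 1)"
    if "k < 2 * s + (2 * N + 1) + 2 * s" "j < N + s" for k j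
  proof (cases "even k")
    case True
    with memo[OF that(1)] have "b (k div 2) \<in> E n m" by (simp add: z_def)
    from S_kernel_odd[OF m ls(2) this[unfolded b_def] vu_mem(2)[OF that(2)]] True show ?thesis
      by (auto simp: z_def b_def u_def)
  next
    case False
    with memo[OF that(1)] have "a (k div 2) \<in> E n m" by (simp add: z_def)
    from S_kernel_even[OF m ls(2) this[unfolded a_def] vu_mem(2)[OF that(2)]] False show ?thesis
      by (auto simp: z_def a_def u_def elim!: oddE)
  qed
  have Kw: "?K (z k) (w q) = of_bool (k = 2 * s + q \<or> k = 2 * s + q + 1)"
    if "k < 2 * s + (2 * N + 1) + 2 * s" "q < 2 * N" for k q
  proof (cases "even q")
    case True
    have "?K (z k) (w q) = of_bool (k div 2 = s + q div 2)"
      using True Kv[OF that(1), of "s + q div 2"] that(2) by (simp add: w_def)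
    moreover have "k div 2 = s + q div 2 \<longleftrightarrow> k = 2 * s + q \<or> k = 2 * s + q + 1" using True by presburger
    ultimately show ?thesis by simp
  next
    case False
    have "?K (z k) (w q) = of_bool ((k + 1) div 2 = q div 2 + s + 1)"
      using False Ku[OF that(1), of "q div 2"] that(2) by (simp add: w_def)
    moreover have "(k + 1) div 2 = q div 2 + s + 1 \<longleftrightarrow> k = 2 * s + q \<or> k = 2 * s + q + 1" using False by presburger
    ultimately show ?thesis by simp
  qed
  let ?Y0 = "map z [0..<2 * s]" and ?Y1 = "map z [2 * s..<2 * s + (2 * N + 1)]"
    and ?Y2 = "map z [2 * s + (2 * N + 1)..<2 * s + (2 * N + 1) + 2 * s]"
    and ?X0 = "map v [0..<s]" and ?X1 = "map w [0..<2 * N]" and ?X2 = "map u [N..<N + s]"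
  have "kernel_mat ?K (?Y0 @ ?Y1 @ ?Y2) (?X0 @ ?X1 @ ?X2)
      = diag_block_mat [kernel_mat ?K ?Y0 ?X0, kernel_mat ?K ?Y1 ?X1, kernel_mat ?K ?Y2 ?X2]"
    by (rule kernel_mat_diag3) (auto simp: Kv Ku Kw)
  moreover have "kernel_mat ?K ?Y0 ?X0 = H_blk s"
    unfolding kernel_mat_map_upt H_blk_def by (rule eq_matI) (auto simp: Kv)
  moreover have "kernel_mat ?K ?Y1 ?X1 = bidiag (2 * 2 ^ n)"
    unfolding kernel_mat_map_upt bidiag_def by (rule eq_matI) (auto simp: Kw simp flip: N_def)
  moreover have "kernel_mat ?K ?Y2 ?X2 = H_blk s"
    unfolding kernel_mat_map_upt H_blk_def by (rule eq_matI) (auto simp: Ku)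
  ultimately show ?thesis by (simp only: inb outb)
qed

text \<open>The two input columns that occur in an output column with indices \<open>l\<close>, \<open>s\<close> belong to the block
  \<open>(l, s)\<close>.\<close>

lemma S_kernel_support:
  assumes m: "0 < m" "m \<le> n"
    and p: "p \<in> set (block_indices n m)" and q: "q \<in> set (block_indices n m)" and "p \<noteq> q"
    and y: "y \<in> set (out_block n m p)" and x: "x \<in> set (in_block n m q)"
  shows "S_kernel n m y x = 0"
proof (rule ccontr)
  assume nz: "S_kernel n m y x \<noteq> 0"
  obtain l s where p': "p = (l, s)" by fastforce
  then have ls: "l < 2 ^ (n - m)" "s < 2 ^ (m - 1)" using p by (simp_all add: block_indices_iff)
  obtain h where y': "y = (h, l * 2 ^ m + 2 * s) \<or> y = (h, l * 2 ^ m + 2 * s + 1)"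
    using y by (auto simp: p' out_block_def set_altcat set_strip)
  have yE: "y \<in> E n m" using y p set_out_order[OF m] by (auto simp: out_order_def)
  have xE: "x \<in> E n (m - 1)" using x q set_in_order[OF m] by (auto simp: in_order_def)
  obtain h' c where x': "x = (h', c)" by fastforce
  have c: "c = 2 * l * 2 ^ (m - 1) + s \<or> c = (2 * l + 1) * 2 ^ (m - 1) + s"
    using y'
  proof
    assume "y = (h, l * 2 ^ m + 2 * s)"
    then show ?thesis using nz yE xE S_kernel_even[OF m ls(2), of h l x] by (auto simp: x')
  next
    assume "y = (h, l * 2 ^ m + 2 * s + 1)"
    then show ?thesis using nz yE xE S_kernel_odd[OF m ls(2), of h l x] by (auto simp: x')
  qed
  obtain l' s' where q': "q = (l', s')" by fastforce
  have "c mod 2 ^ (m - 1) = s"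
    using c by (elim disjE) (simp_all only: div_mod_block[OF ls(2)])
  then have "x \<in> set (in_block n m p)"
    using c xE by (auto simp: x' p' in_block_def set_altcat set_strip E_def)
  then have "q = p"
    using x p q by (auto simp: x' p' q' block_indices_iff in_block_mem[OF m])
  then show False using \<open>p \<noteq> q\<close> by simp
qed

lemma S_reordered:
  assumes m: "0 < m" "m \<le> n"
  shows "kernel_mat (S_kernel n m) (out_order n m) (in_order n m)
    = diag_block_mat (map (\<lambda>(l, s). diag_block_mat [H_blk s, bidiag (2 * 2 ^ n), H_blk s]) (block_indices n m))"
proof -
  have "kernel_mat (S_kernel n m) (out_order n m) (in_order n m)
      = diag_block_mat (map (\<lambda>p. kernel_mat (S_kernel n m) (out_block n m p) (in_block n m p)) (block_indices n m))"
    unfolding out_order_def in_order_def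
    by (rule kernel_mat_concat[OF distinct_block_indices]) (rule S_kernel_support[OF m])
  also have "map (\<lambda>p. kernel_mat (S_kernel n m) (out_block n m p) (in_block n m p)) (block_indices n m)
      = map (\<lambda>(l, s). diag_block_mat [H_blk s, bidiag (2 * 2 ^ n), H_blk s]) (block_indices n m)"
    by (rule map_cong[OF refl]) (auto simp only: block_indices_iff block_is_diag[OF m])
  finally show ?thesis .
qed

section \<open>The singular value decomposition\<close>

lemma gram_diag_block:
  "transpose_mat (diag_block_mat As) * diag_block_mat As
     = diag_block_mat (map (\<lambda>A :: real mat. transpose_mat A * A) As)"
  using diag_block_mat_transpose[of "\<lambda>A. A" As] diag_block_mat_mult[of As transpose_mat "\<lambda>A. A"] by simp

lemma diag_with_gram_diag_block:
  assumes "\<And>A. A \<in> set As \<Longrightarrow> diag_with P (transpose_mat A * A)"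
  shows "diag_with P (transpose_mat (diag_block_mat As) * diag_block_mat As)"
  unfolding gram_diag_block using assms by (intro diag_with_diag_block) auto

lemma orthonormal_diag_block:
  fixes As :: "real mat list"
  assumes "\<And>A. A \<in> set As \<Longrightarrow> transpose_mat A * A = 1\<^sub>m (dim_col A)"
  shows "transpose_mat (diag_block_mat As) * diag_block_mat As = 1\<^sub>m (dim_col (diag_block_mat As))"
proof -
  have eq: "map (\<lambda>A. transpose_mat A * A) As = map (\<lambda>A. 1\<^sub>m (dim_col A)) As" using assms by simp
  show ?thesis unfolding gram_diag_block eq diag_block_mat_one dim_diag_block_mat ..
qed

lemma diag_block_mat_mult3:
  fixes A0 :: "'a::semiring_0 mat"
  assumes "dim_col A0 = dim_row B0" "dim_col A1 = dim_row B1" "dim_col A2 = dim_row B2"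
  shows "diag_block_mat [A0, A1, A2] * diag_block_mat [B0, B1, B2] = diag_block_mat [A0 * B0, A1 * B1, A2 * B2]"
proof -
  have "dim_col ([A0, A1, A2] ! p) = dim_row ([B0, B1, B2] ! p)" if "p \<in> set [0, 1, 2]" for p
    using that assms by (auto simp: numeral_2_eq_2)
  from diag_block_mat_mult[where ps = "[0, 1, 2]" and A = "(!) [A0, A1, A2]" and B = "(!) [B0, B1, B2]", OF this]
  show ?thesis
    by (simp add: numeral_2_eq_2 del: diag_block_mat.simps)
qed

lemma transpose_diag3:
  "transpose_mat (diag_block_mat [A0, A1, A2]) = diag_block_mat [transpose_mat A0, transpose_mat A1, transpose_mat A2]"
  using diag_block_mat_transpose[of "\<lambda>A. A" "[A0, A1, A2]"] by (simp del: diag_block_mat.simps)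

lemma H_blk_dim [simp]: "dim_row (H_blk s) = 2 * s" "dim_col (H_blk s) = s"
  and U_plus_dim [simp]: "dim_row (U_plus t) = t + 1" "dim_col (U_plus t) = t"
  and V_plus_dim [simp]: "dim_row (V_plus t) = t" "dim_col (V_plus t) = t"
  and Sigma_plus_dim [simp]: "dim_row (Sigma_plus t) = t" "dim_col (Sigma_plus t) = t"
  by (simp_all add: H_blk_def U_plus_def V_plus_def Sigma_plus_def)

lemma H_blk_gram: "diag_with (\<lambda>x. 0 < x) (transpose_mat (H_blk s) * H_blk s)"
proof -
  have entry: "(transpose_mat (H_blk s) * H_blk s) $$ (i, j) = (\<Sum>k<2 * s. H_blk s $$ (k, i) * H_blk s $$ (k, j))"
    if "i < s" "j < s" for i j
    using that by (auto simp: scalar_prod_def lessThan_atLeast0 intro!: sum.cong)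
  have "(transpose_mat (H_blk s) * H_blk s) $$ (i, j) = 0" if "i < s" "j < s" "i \<noteq> j" for i j
    unfolding entry[OF that(1,2)] using that by (intro sum.neutral) (auto simp: H_blk_def)
  moreover have "0 < (transpose_mat (H_blk s) * H_blk s) $$ (i, i)" if "i < s" for i
    unfolding entry[OF that that] using that
    by (intro sum_pos2[of _ "2 * i"]) (auto simp: H_blk_def)
  ultimately show ?thesis by (simp add: diag_with_def diagonal_mat_def)
qed

lemma U_blk_gram: "diag_with (\<lambda>x. 0 < x) (transpose_mat (U_blk r s) * U_blk r s)"
  unfolding U_blk_def
  by (rule diag_with_gram_diag_block) (auto simp: H_blk_gram U_plus_orthogonal diag_with_one)

lemma V_blk_orthonormal: "transpose_mat (V_blk r s) * V_blk r s = 1\<^sub>m (dim_col (V_blk r s))"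
  unfolding V_blk_def by (rule orthonormal_diag_block) (auto simp: V_plus_orthogonal)

lemma Sigma_plus_diag: "diag_with (\<lambda>x. 0 \<le> x) (Sigma_plus t)"
proof -
  have "0 \<le> cos (real (j + 1) * pi / (2 * real t + 2))" if "j < t" for j
  proof (rule cos_ge_zero)
    have "real (j + 1) * pi \<le> real (t + 1) * pi" using that by (intro mult_right_mono) auto
    then show "real (j + 1) * pi / (2 * real t + 2) \<le> pi / 2" by (simp add: field_simps)
    have "0 \<le> real (j + 1) * pi / (2 * real t + 2)" by simp
    then show "- (pi / 2) \<le> real (j + 1) * pi / (2 * real t + 2)" using pi_ge_zero by linarith
  qed
  then show ?thesis by (auto simp: diag_with_def diagonal_mat_def Sigma_plus_def)
qed

lemma Sigma_blk_diag: "diag_with (\<lambda>x. 0 \<le> x) (Sigma_blk r s)"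
  unfolding Sigma_blk_def
  by (rule diag_with_diag_block) (auto simp: Sigma_plus_diag diag_with_one)

lemma V_blk_symmetric: "transpose_mat (V_blk r s) = V_blk r s"
  unfolding V_blk_def transpose_diag3 by (simp add: V_plus_symmetric)

lemma blk_dims:
  "dim_col (U_blk r s) = dim_col (V_blk r s)" "dim_row (V_blk r s) = dim_col (V_blk r s)"
  "dim_row (Sigma_blk r s) = dim_col (V_blk r s)" "dim_col (Sigma_blk r s) = dim_col (V_blk r s)"
  by (simp_all add: U_blk_def V_blk_def Sigma_blk_def Let_def)

lemma block_factorization:
  "U_blk r s * Sigma_blk r s * transpose_mat (V_blk r s) = diag_block_mat [H_blk s, bidiag (2 * (r - s)), H_blk s]"
proof -
  have H: "H_blk s * 1\<^sub>m s * 1\<^sub>m s = H_blk s"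
    by (simp add: right_mult_one_mat[of _ "2 * s"] carrier_matI)
  have US: "U_blk r s * Sigma_blk r s
      = diag_block_mat [H_blk s * 1\<^sub>m s, U_plus (2 * (r - s)) * Sigma_plus (2 * (r - s)), H_blk s * 1\<^sub>m s]"
    unfolding U_blk_def Sigma_blk_def by (rule diag_block_mat_mult3) simp_all
  have V: "transpose_mat (V_blk r s) = diag_block_mat [1\<^sub>m s, transpose_mat (V_plus (2 * (r - s))), 1\<^sub>m s]"
    unfolding V_blk_def transpose_diag3 transpose_one ..
  have "U_blk r s * Sigma_blk r s * transpose_mat (V_blk r s)
      = diag_block_mat [H_blk s * 1\<^sub>m s * 1\<^sub>m s,
          U_plus (2 * (r - s)) * Sigma_plus (2 * (r - s)) * transpose_mat (V_plus (2 * (r - s))),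
          H_blk s * 1\<^sub>m s * 1\<^sub>m s]"
    unfolding US V by (rule diag_block_mat_mult3) simp_all
  then show ?thesis unfolding H bidiag_svd .
qed

lemma level_dims:
  "dim_col (level_diag U_blk n m) = dim_col (level_diag V_blk n m)"
  "dim_row (level_diag V_blk n m) = dim_col (level_diag V_blk n m)"
  "dim_row (level_diag Sigma_blk n m) = dim_col (level_diag V_blk n m)"
  "dim_col (level_diag Sigma_blk n m) = dim_col (level_diag V_blk n m)"
  unfolding level_diag_blocks dim_diag_block_mat map_map
  by (auto intro!: arg_cong[of _ _ sum_list] simp: blk_dims)

lemma level_factorization:
  assumes m: "0 < m" "m \<le> n"
  shows "level_diag U_blk n m * level_diag Sigma_blk n m * transpose_mat (level_diag V_blk n m)
     = kernel_mat (S_kernel n m) (out_order n m) (in_order n m)"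
proof -
  let ?B = "\<lambda>B :: nat \<Rightarrow> nat \<Rightarrow> real mat. \<lambda>(l :: nat, s). B (2 ^ n + s) s"
  have tr: "transpose_mat (level_diag V_blk n m)
      = diag_block_mat (map (\<lambda>p. transpose_mat (?B V_blk p)) (block_indices n m))"
    unfolding level_diag_blocks by (rule diag_block_mat_transpose)
  have US: "level_diag U_blk n m * level_diag Sigma_blk n m
      = diag_block_mat (map (\<lambda>p. ?B U_blk p * ?B Sigma_blk p) (block_indices n m))"
    unfolding level_diag_blocks by (rule diag_block_mat_mult) (auto simp: blk_dims)
  have "level_diag U_blk n m * level_diag Sigma_blk n m * transpose_mat (level_diag V_blk n m)
      = diag_block_mat (map (\<lambda>p. ?B U_blk p * ?B Sigma_blk p * transpose_mat (?B V_blk p)) (block_indices n m))"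
    unfolding US tr by (rule diag_block_mat_mult) (auto simp: blk_dims)
  also have "map (\<lambda>p. ?B U_blk p * ?B Sigma_blk p * transpose_mat (?B V_blk p)) (block_indices n m)
      = map (\<lambda>(l, s). diag_block_mat [H_blk s, bidiag (2 * 2 ^ n), H_blk s]) (block_indices n m)"
    by (rule map_cong[OF refl]) (auto simp: block_factorization simp del: diag_block_mat.simps)
  finally show ?thesis by (simp only: S_reordered[OF m])
qed

lemma level_U_gram: "diag_with (\<lambda>x. 0 < x) (transpose_mat (level_diag U_blk n m) * level_diag U_blk n m)"
  unfolding level_diag_blocks by (rule diag_with_gram_diag_block) (auto simp: U_blk_gram)

lemma level_V_orthonormal:
  "transpose_mat (level_diag V_blk n m) * level_diag V_blk n m = 1\<^sub>m (dim_col (level_diag V_blk n m))"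
  unfolding level_diag_blocks by (rule orthonormal_diag_block) (auto simp: V_blk_orthonormal)

lemma level_V_symmetric: "transpose_mat (level_diag V_blk n m) = level_diag V_blk n m"
  unfolding level_diag_blocks diag_block_mat_transpose
  by (rule arg_cong[of _ _ diag_block_mat]) (auto simp: V_blk_symmetric)

lemma level_Sigma_diag: "diag_with (\<lambda>x. 0 \<le> x) (level_diag Sigma_blk n m)"
  unfolding level_diag_blocks by (rule diag_with_diag_block) (auto simp: Sigma_blk_diag)

lemma kron_one_mult:
  fixes A B :: "real mat"
  assumes "dim_col A = dim_row B"
  shows "kron (1\<^sub>m k) A * kron (1\<^sub>m k) B = kron (1\<^sub>m k) (A * B)"
  using diag_block_mat_mult[of "[0..<k]" "\<lambda>_. A" "\<lambda>_. B"] assms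
  by (simp add: kron_one map_replicate_const)

lemma kron_one_transpose: "transpose_mat (kron (1\<^sub>m k) A) = kron (1\<^sub>m k) (transpose_mat A)"
  using diag_block_mat_transpose[of "\<lambda>_. A" "[0..<k]"] by (simp add: kron_one map_replicate_const)

lemma kron_one_dim: "dim_row (kron (1\<^sub>m k) A) = k * dim_row A" "dim_col (kron (1\<^sub>m k) A) = k * dim_col A"
  by (simp_all add: kron_def)

text \<open>A factorization whose left factor has orthogonal nonzero columns becomes a singular value
  decomposition once the lengths of these columns are moved into the diagonal factor.\<close>

lemma svd_from_orthogonal_columns:
  assumes U: "U \<in> carrier_mat r k" and S: "S \<in> carrier_mat k k" and V: "V \<in> carrier_mat c k"
    and A: "A = U * S * transpose_mat V" and k: "k = min r c"
    and gram: "diag_with (\<lambda>x. 0 < x) (transpose_mat U * U)"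
    and VV: "transpose_mat V * V = 1\<^sub>m k"
    and diag: "diag_with (\<lambda>x. 0 \<le> x) S"
  shows "is_svd A (normalize_cols U) (col_norms U * S) V"
proof -
  have pos: "0 < col U j \<bullet> col U j" if "j < k" for j
    using gram that U by (auto simp: diag_with_def)
  then have norm: "0 < col_norm U j" "col_norm U j * col_norm U j = col U j \<bullet> col U j" if "j < k" for j
    using that by (auto simp: col_norm_def less_imp_le)
  have orth: "col U i \<bullet> col U j = 0" if "i < k" "j < k" "i \<noteq> j" for i j
    using gram that U by (auto simp: diag_with_def diagonal_mat_def)
  have N: "normalize_cols U \<in> carrier_mat r k" and D: "col_norms U \<in> carrier_mat k k"
    using U by (simp_all add: normalize_cols_def col_norms_def)
  have D': "diagonal_mat (col_norms U)" by (simp add: diagonal_mat_def col_norms_def)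
  have ND: "normalize_cols U * col_norms U = U"
  proof (rule eq_matI)
    fix i j assume ij: "i < dim_row U" "j < dim_col U"
    then have "(normalize_cols U * col_norms U) $$ (i, j) = normalize_cols U $$ (i, j) * col_norms U $$ (j, j)"
      using U N by (intro mult_diagonal_index[OF D D']) auto
    then show "(normalize_cols U * col_norms U) $$ (i, j) = U $$ (i, j)"
      using ij U norm(1)[of j] by (simp add: normalize_cols_def col_norms_def)
  qed (use U N D in auto)
  have NN: "transpose_mat (normalize_cols U) * normalize_cols U = 1\<^sub>m k"
  proof (rule eq_matI)
    fix i j assume "i < dim_row (1\<^sub>m k :: real mat)" "j < dim_col (1\<^sub>m k :: real mat)"
    then have ij: "i < k" "j < k" by simp_all
    have "(transpose_mat (normalize_cols U) * normalize_cols U) $$ (i, j)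
        = (\<Sum>l<r. U $$ (l, i) / col_norm U i * (U $$ (l, j) / col_norm U j))"
      using ij U by (auto simp: normalize_cols_def scalar_prod_def lessThan_atLeast0 intro!: sum.cong)
    also have "\<dots> = (\<Sum>l<r. U $$ (l, i) * U $$ (l, j)) / (col_norm U i * col_norm U j)"
      by (simp add: sum_divide_distrib)
    also have "(\<Sum>l<r. U $$ (l, i) * U $$ (l, j)) = col U i \<bullet> col U j"
      using ij U by (auto simp: scalar_prod_def lessThan_atLeast0 intro!: sum.cong)
    also have "col U i \<bullet> col U j / (col_norm U i * col_norm U j) = 1\<^sub>m k $$ (i, j)"
      using ij norm[of i] pos[of i] orth[of i j] by (cases "i = j") auto
    finally show "(transpose_mat (normalize_cols U) * normalize_cols U) $$ (i, j) = 1\<^sub>m k $$ (i, j)" .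
  qed (use N in auto)
  have S': "diagonal_mat S" "\<And>j. j < k \<Longrightarrow> 0 \<le> S $$ (j, j)" using diag S by (auto simp: diag_with_def)
  have DS: "(col_norms U * S) $$ (i, j) = col_norms U $$ (i, j) * S $$ (j, j)" if "i < k" "j < k" for i j
    using that D by (intro mult_diagonal_index[OF S S'(1)]) auto
  have "diagonal_mat (col_norms U * S)"
    unfolding diagonal_mat_def using D D' S DS by (auto simp: diagonal_mat_def)
  moreover have "0 \<le> (col_norms U * S) $$ (j, j)" if "j < k" for j
    unfolding DS[OF that that] using that U norm(1)[of j] S'(2)[of j] by (simp add: col_norms_def)
  moreover have "A = normalize_cols U * (col_norms U * S) * transpose_mat V"
    unfolding A using ND assoc_mult_mat[OF N D S] by simp
  moreover have "dim_row A = r" "dim_col A = c" unfolding A using U V by auto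
  ultimately show ?thesis
    unfolding is_svd_def Let_def using N D S V NN VV k by auto
qed

lemma finite_E: "finite (E n k)"
  by (metis List.finite_set set_E_list)

text \<open>So the smaller of the two dimensions, which is the number of singular values, is the number of
  inputs.\<close>

lemma card_E_mono: "card (E n (m - 1)) \<le> card (E n m)"
proof (rule card_mono[OF finite_E])
  have "c mod 2 ^ (m - 1) \<le> c mod 2 ^ m" for c :: nat
  proof -
    have "c mod 2 ^ (m - 1) = c mod 2 ^ m mod 2 ^ (m - 1)"
      by (simp add: mod_mod_cancel le_imp_power_dvd)
    then show ?thesis by simp
  qed
  then have "- int (c mod 2 ^ m) \<le> - int (c mod 2 ^ (m - 1))" for c :: nat by simp
  then show "E n (m - 1) \<subseteq> E n m" unfolding E_def by (blast intro: order_trans)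
qed

lemma P_mat_carrier: "P_mat n m \<in> carrier_mat (card (E n (m - 1))) (card (E n (m - 1)))"
  and Q_mat_carrier: "Q_mat n m \<in> carrier_mat (card (E n m)) (card (E n m))"
  and S_mat_carrier: "S_mat n m \<in> carrier_mat (card (E n m)) (card (E n (m - 1)))"
  by (simp_all add: P_mat_def Q_mat_def S_mat_def)

context
  fixes n m :: nat
  assumes m: "0 < m" "m \<le> n"
begin

lemma level_U_carrier: "level_diag U_blk n m \<in> carrier_mat (card (E n m)) (card (E n (m - 1)))"
  and level_Sigma_carrier: "level_diag Sigma_blk n m \<in> carrier_mat (card (E n (m - 1))) (card (E n (m - 1)))"
  and level_V_carrier: "level_diag V_blk n m \<in> carrier_mat (card (E n (m - 1))) (card (E n (m - 1)))"
proof -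
  have U: "dim_row (level_diag U_blk n m) = card (E n m)"
    using arg_cong[OF level_factorization[OF m], of dim_row] by (simp add: length_out_order[OF m])
  have "dim_row (level_diag V_blk n m) = card (E n (m - 1))"
    using arg_cong[OF level_factorization[OF m], of dim_col] by (simp add: length_in_order[OF m])
  then have V: "dim_col (level_diag V_blk n m) = card (E n (m - 1))"
    by (simp only: level_dims(2))
  show "level_diag U_blk n m \<in> carrier_mat (card (E n m)) (card (E n (m - 1)))"
    "level_diag Sigma_blk n m \<in> carrier_mat (card (E n (m - 1))) (card (E n (m - 1)))"
    "level_diag V_blk n m \<in> carrier_mat (card (E n (m - 1))) (card (E n (m - 1)))"
    by (rule carrier_matI; simp only: level_dims U V)+
qed

lemma Q_mat_orthogonal: "transpose_mat (Q_mat n m) * Q_mat n m = 1\<^sub>m (card (E n m))"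
  by (simp only: Q_mat_eq[OF m] transpose_match_mat match_mat_mult[OF distinct_E_list] set_E_list set_out_order[OF m]
      match_mat_self[OF distinct_out_order[OF m]] length_out_order[OF m] order_refl)

lemma P_mat_orthogonal: "P_mat n m * transpose_mat (P_mat n m) = 1\<^sub>m (card (E n (m - 1)))"
  by (simp only: P_mat_eq[OF m] transpose_match_mat match_mat_mult[OF distinct_E_list] set_E_list set_in_order[OF m]
      match_mat_self[OF distinct_in_order[OF m]] length_in_order[OF m] order_refl)

lemma S_mat_factorization:
  "S_mat n m = Q_mat n m * level_diag U_blk n m * level_diag Sigma_blk n m
     * transpose_mat (transpose_mat (P_mat n m) * level_diag V_blk n m)"
proof -
  note c = Q_mat_carrier[of n m] level_U_carrier level_Sigma_carrier level_V_carrier P_mat_carrier[of n m]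
  have "S_mat n m = Q_mat n m * kernel_mat (S_kernel n m) (out_order n m) (in_order n m) * P_mat n m"
    unfolding Q_mat_eq[OF m] P_mat_eq[OF m] S_mat_eq
    by (simp only: match_mat_mult[OF distinct_out_order[OF m]] kernel_mat_mult_eq[OF distinct_in_order[OF m]]
        set_E_list set_in_order[OF m] set_out_order[OF m] order_refl)
  also have "\<dots> = Q_mat n m * (level_diag U_blk n m * level_diag Sigma_blk n m * transpose_mat (level_diag V_blk n m)) * P_mat n m"
    by (simp only: level_factorization[OF m])
  also have "\<dots> = Q_mat n m * level_diag U_blk n m * level_diag Sigma_blk n m
     * (transpose_mat (level_diag V_blk n m) * P_mat n m)"
    using c by (simp add: assoc_mult_mat[of _ "card (E n m)" "card (E n m)" _ "card (E n (m - 1))" _ "card (E n (m - 1))"]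
      assoc_mult_mat[of _ "card (E n m)" "card (E n (m - 1))" _ "card (E n (m - 1))" _ "card (E n (m - 1))"])
  also have "transpose_mat (level_diag V_blk n m) * P_mat n m = transpose_mat (transpose_mat (P_mat n m) * level_diag V_blk n m)"
    using c by (subst transpose_mult[of _ "card (E n (m - 1))" "card (E n (m - 1))" _ "card (E n (m - 1))"]) auto
  finally show ?thesis .
qed

lemma QU_gram:
  "transpose_mat (Q_mat n m * level_diag U_blk n m) * (Q_mat n m * level_diag U_blk n m)
     = transpose_mat (level_diag U_blk n m) * level_diag U_blk n m"
proof -
  let ?Q = "Q_mat n m" and ?L = "level_diag U_blk n m"
  note Q = Q_mat_carrier[of n m] and L = level_U_carrier
  have "transpose_mat (?Q * ?L) * (?Q * ?L) = transpose_mat ?L * transpose_mat ?Q * (?Q * ?L)"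
    by (simp only: transpose_mult[OF Q L])
  also have "\<dots> = transpose_mat ?L * (transpose_mat ?Q * (?Q * ?L))"
    using Q L by (intro assoc_mult_mat) auto
  also have "transpose_mat ?Q * (?Q * ?L) = transpose_mat ?Q * ?Q * ?L"
    using Q L by (intro assoc_mult_mat[symmetric]) auto
  also have "\<dots> = ?L" using L by (simp add: Q_mat_orthogonal)
  finally show ?thesis .
qed

lemma PV_orthonormal:
  "transpose_mat (transpose_mat (P_mat n m) * level_diag V_blk n m) * (transpose_mat (P_mat n m) * level_diag V_blk n m)
     = 1\<^sub>m (card (E n (m - 1)))"
proof -
  let ?P = "P_mat n m" and ?L = "level_diag V_blk n m"
  note P = P_mat_carrier[of n m] and L = level_V_carrier
  have P': "transpose_mat ?P \<in> carrier_mat (card (E n (m - 1))) (card (E n (m - 1)))" using P by simp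
  have "transpose_mat (transpose_mat ?P * ?L) * (transpose_mat ?P * ?L) = transpose_mat ?L * ?P * (transpose_mat ?P * ?L)"
    by (simp only: transpose_mult[OF P' L] transpose_transpose)
  also have "\<dots> = transpose_mat ?L * (?P * (transpose_mat ?P * ?L))"
    using P L by (intro assoc_mult_mat) auto
  also have "?P * (transpose_mat ?P * ?L) = ?P * transpose_mat ?P * ?L"
    using P L by (intro assoc_mult_mat[symmetric]) auto
  also have "\<dots> = ?L" using L by (simp add: P_mat_orthogonal)
  also have "transpose_mat ?L * ?L = 1\<^sub>m (card (E n (m - 1)))"
    using L by (simp add: level_V_orthonormal)
  finally show ?thesis .
qed

lemma full_carriers:
  "U_full n m \<in> carrier_mat (4 * card (E n m)) (4 * card (E n (m - 1)))"
  "Sigma_full n m \<in> carrier_mat (4 * card (E n (m - 1))) (4 * card (E n (m - 1)))"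
  "V_full n m \<in> carrier_mat (4 * card (E n (m - 1))) (4 * card (E n (m - 1)))"
  using Q_mat_carrier[of n m] P_mat_carrier[of n m] level_U_carrier level_Sigma_carrier level_V_carrier
  by (auto simp: U_full_def Sigma_full_def V_full_def kron_one_dim intro!: carrier_matI)

lemma S_full_factorization: "S_full n m = U_full n m * Sigma_full n m * transpose_mat (V_full n m)"
  unfolding S_full_def U_full_def Sigma_full_def V_full_def kron_one_transpose S_mat_factorization
  using Q_mat_carrier[of n m] P_mat_carrier[of n m] level_U_carrier level_Sigma_carrier level_V_carrier
  by (simp add: kron_one_mult)

lemma S_full_svd:
  "is_svd (S_full n m) (normalize_cols (U_full n m)) (col_norms (U_full n m) * Sigma_full n m) (V_full n m)"
proof (rule svd_from_orthogonal_columns[OF full_carriers S_full_factorization])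
  show "4 * card (E n (m - 1)) = min (4 * card (E n m)) (4 * card (E n (m - 1)))"
    using card_E_mono by simp
  show "diag_with (\<lambda>x. 0 < x) (transpose_mat (U_full n m) * U_full n m)"
    unfolding U_full_def kron_one
    by (rule diag_with_gram_diag_block) (simp add: QU_gram level_U_gram)
  show "transpose_mat (V_full n m) * V_full n m = 1\<^sub>m (4 * card (E n (m - 1)))"
  proof -
    let ?W = "transpose_mat (P_mat n m) * level_diag V_blk n m"
    have "transpose_mat (V_full n m) * V_full n m = 1\<^sub>m (dim_col (V_full n m))"
      unfolding V_full_def kron_one
      by (rule orthonormal_diag_block) (use level_V_carrier in \<open>simp add: PV_orthonormal\<close>)
    then show ?thesis using full_carriers(3) by simp
  qed
  show "diag_with (\<lambda>x. 0 \<le> x) (Sigma_full n m)"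
    unfolding Sigma_full_def kron_one by (rule diag_with_diag_block) (simp add: level_Sigma_diag)
qed

end
section \<open>Linear computations\<close>

text \<open>\<open>lin_chain F c G\<close>: the functions in \<open>G\<close> can be obtained from those in \<open>F\<close> by at most \<open>c\<close> steps, each of
  which adds a linear combination of two functions that are already available. Copying and
  rearranging cost nothing in this measure.\<close>

inductive lin_chain :: "('x \<Rightarrow> 'k::field) set \<Rightarrow> nat \<Rightarrow> ('x \<Rightarrow> 'k) set \<Rightarrow> bool" where
  stop: "G \<subseteq> F \<Longrightarrow> lin_chain F c G"
| step: "f \<in> F \<Longrightarrow> g \<in> F \<Longrightarrow> lin_chain (insert (\<lambda>x. a * f x + b * g x) F) c G
    \<Longrightarrow> lin_chain F (Suc c) G"

lemma lin_chain_mono: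
  assumes "lin_chain F c G" "F \<subseteq> F'" "G' \<subseteq> G" "c \<le> c'"
  shows "lin_chain F' c' G'"
  using assms
proof (induction arbitrary: F' c' rule: lin_chain.induct)
  case (stop G F c)
  then show ?case by (blast intro: lin_chain.stop)
next
  case (step f F g a b c G)
  then obtain d where "c' = Suc d" "c \<le> d" by (cases c') auto
  moreover have "lin_chain (insert (\<lambda>x. a * f x + b * g x) F') d G'"
    using step calculation by (intro step.IH) auto
  ultimately show ?case using step.hyps step.prems by (auto intro!: lin_chain.step[of f F' g a b])
qed

lemma lin_chain_trans:
  assumes "lin_chain F c G" "lin_chain (F \<union> G) d H"
  shows "lin_chain F (c + d) H"
  using assms
proof (induction rule: lin_chain.induct)
  case (stop G F c)
  then have "F \<union> G = F" by blast
  with stop.prems show ?case by (auto intro: lin_chain_mono[OF _ order_refl order_refl])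
next
  case (step f F g a b c G)
  have "lin_chain (insert (\<lambda>x. a * f x + b * g x) F \<union> G) d H"
    using step.prems by (rule lin_chain_mono) auto
  then have "lin_chain (insert (\<lambda>x. a * f x + b * g x) F) (c + d) H" by (rule step.IH)
  then show ?case using step.hyps by (auto intro: lin_chain.step)
qed

text \<open>Nothing is ever overwritten.\<close>

lemma lin_chain_keep: "lin_chain F c G \<Longrightarrow> lin_chain F c (F \<union> G)"
proof (induction rule: lin_chain.induct)
  case (step f F g a b c G)
  have "lin_chain (insert (\<lambda>x. a * f x + b * g x) F) c (F \<union> G)"
    using step.IH by (rule lin_chain_mono) auto
  then show ?case using step.hyps by (auto intro: lin_chain.step)
qed (auto intro: lin_chain.stop)

lemma lin_chain_union:
  assumes "lin_chain F c G" "lin_chain F d H"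
  shows "lin_chain F (c + d) (G \<union> H)"
proof -
  have "lin_chain (F \<union> G) d H" using assms(2) by (rule lin_chain_mono) auto
  then have "lin_chain (F \<union> G) d (G \<union> H)" by (rule lin_chain_mono[OF lin_chain_keep]) auto
  with assms(1) show ?thesis by (rule lin_chain_trans)
qed

lemma lin_chain_trans':
  assumes "lin_chain F c G" "lin_chain G d H"
  shows "lin_chain F (c + d) H"
  using assms(1) lin_chain_mono[OF assms(2) Un_upper2 order_refl order_refl] by (rule lin_chain_trans)

text \<open>The key to composing computations: a chain stays a chain when other functions are substituted
  for its inputs.\<close>

lemma lin_chain_comp: "lin_chain F c G \<Longrightarrow> lin_chain ((\<lambda>f. f \<circ> \<phi>) ` F) c ((\<lambda>f. f \<circ> \<phi>) ` G)"
proof (induction rule: lin_chain.induct)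
  case (step f F g a b c G)
  then show ?case
    by (intro lin_chain.step[of "f \<circ> \<phi>" _ "g \<circ> \<phi>" a b]) (auto simp: o_def)
qed (auto intro: lin_chain.stop)

lemma lin_chain_single:
  assumes "f \<in> F" "g \<in> F"
  shows "lin_chain F 1 {\<lambda>x. a * f x + b * g x}"
  using lin_chain.step[of f F g a b 0, OF assms] by (simp add: lin_chain.stop)

lemma lin_chain_image:
  assumes "finite I"
    and "\<And>i. i \<in> I \<Longrightarrow> \<exists>f\<in>F. \<exists>g\<in>F. \<exists>a b. h i = (\<lambda>x. a * f x + b * g x)"
  shows "lin_chain F (card I) (h ` I)"
  using assms
proof (induction I rule: finite_induct)
  case (insert i I)
  obtain f g a b where "f \<in> F" "g \<in> F" and h: "h i = (\<lambda>x. a * f x + b * g x)"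
    using insert.prems by blast
  then have "lin_chain F 1 {h i}" using lin_chain_single by simp
  moreover have "lin_chain F (card I) (h ` I)" using insert by blast
  ultimately have "lin_chain F (1 + card I) ({h i} \<union> h ` I)" by (rule lin_chain_union)
  then show ?case using insert by simp
qed (simp add: lin_chain.stop)

lemma lin_chain_image_scaled:
  assumes "finite I" and "\<And>i. i \<in> I \<Longrightarrow> \<exists>f\<in>F. \<exists>a. h i = (\<lambda>x. a * f x)"
  shows "lin_chain F (card I) (h ` I)"
proof (rule lin_chain_image)
  fix i assume "i \<in> I"
  then obtain f a where "f \<in> F" "h i = (\<lambda>x. a * f x)" using assms(2) by blast
  then show "\<exists>f\<in>F. \<exists>g\<in>F. \<exists>a b. h i = (\<lambda>x. a * f x + b * g x)"
    by (intro bexI[of _ f] exI[of _ a] exI[of _ 0]) auto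
qed fact

section \<open>Toeplitz matrices and chirp transforms\<close>

lemma sum_lessThan_add: "(\<Sum>j<a + b. g j) = (\<Sum>j<a. g j) + (\<Sum>j<b. g (a + j :: nat) :: 'a::comm_monoid_add)"
  by (induction b) (simp_all add: add.assoc)

text \<open>The matrix with entries \<open>\<epsilon>(i - j)\<close>, where lowering the argument by the size multiplies \<open>\<epsilon>\<close>
  by \<open>c\<close>, describes multiplication by a fixed polynomial modulo \<open>x\<^sup>K - c\<close>. For size \<open>2K\<close> and
  \<open>c = d\<^sup>2\<close>, reduction modulo \<open>x\<^sup>K - d\<close> and \<open>x\<^sup>K + d\<close> gives two products of size \<open>K\<close>, and the
  Chinese remainder theorem combines them. On the level of \<open>\<epsilon>\<close> the splitting is
  \<open>\<epsilon> = (\<epsilon>\<^sub>+ + \<epsilon>\<^sub>-) / 2\<close>, where lowering the argument by \<open>K\<close> multiplies \<open>\<epsilon>\<^sub>+\<close> by \<open>d\<close> and \<open>\<epsilon>\<^sub>-\<close>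
  by \<open>-d\<close>. Besides the two recursive calls there are \<open>4K\<close> steps.\<close>

lemma twisted_circulant_chain:
  fixes \<epsilon> :: "int \<Rightarrow> complex" and f :: "nat \<Rightarrow> 'x \<Rightarrow> complex"
  assumes "c \<noteq> 0" "\<And>z. \<epsilon> (z - 2 ^ k) = c * \<epsilon> z"
  shows "lin_chain (f ` {..<2 ^ k}) ((2 * k + 1) * 2 ^ k)
           ((\<lambda>i x. \<Sum>j<2 ^ k. \<epsilon> (int i - int j) * f j x) ` {..<2 ^ k})"
  using assms
proof (induction k arbitrary: \<epsilon> c f)
  case 0
  have "lin_chain (f ` {0}) (card {0::nat}) ((\<lambda>i x. \<epsilon> 0 * f 0 x) ` {0::nat})"
    by (rule lin_chain_image_scaled) auto
  then show ?case by (simp add: lessThan_Suc)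
next
  case (Suc k)
  define K :: nat where "K = 2 ^ k"
  have K: "2 ^ Suc k = K + K" "(2::int) ^ k = int K" "(2::int) ^ Suc k = 2 * int K" "(2::nat) ^ k = K"
    by (simp_all add: K_def)
  define d where "d = csqrt c"
  have d: "d \<noteq> 0" "c = d * d" using Suc.prems(1) by (simp_all add: d_def flip: power2_eq_square)
  have per: "\<epsilon> (z - 2 * int K) = d * d * \<epsilon> z" for z using Suc.prems(2)[of z] by (simp add: K d)
  \<comment> \<open>\<open>ep\<close> and \<open>em\<close> are \<open>\<epsilon>\<^sub>+\<close> and \<open>\<epsilon>\<^sub>-\<close>; \<open>u\<close> and \<open>v\<close> are the residues of the input.\<close>
  define ep where "ep z = \<epsilon> z + \<epsilon> (z - int K) / d" for z
  define em where "em z = \<epsilon> z - \<epsilon> (z - int K) / d" for z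
  define u where "u j = (\<lambda>x. 1 * f j x + d * f (j + K) x)" for j
  define v where "v j = (\<lambda>x. 1 * f j x + (- d) * f (j + K) x)" for j
  define y1 where "y1 = (\<lambda>i x. \<Sum>j<K. ep (int i - int j) * u j x)"
  define y2 where "y2 = (\<lambda>i x. \<Sum>j<K. em (int i - int j) * v j x)"
  define y where "y = (\<lambda>i x. \<Sum>j<K + K. \<epsilon> (int i - int j) * f j x)"
  let ?F = "f ` {..<K + K}"
  have shift: "\<epsilon> (z - int K - int K) = d * d * \<epsilon> z" for z using per[of z] by (simp add: algebra_simps)
  have IH1: "lin_chain (u ` {..<K}) ((2 * k + 1) * K) (y1 ` {..<K})"
    unfolding y1_def K(4)[symmetric]
    by (rule Suc.IH[of d]) (use d shift in \<open>auto simp: ep_def K field_simps\<close>)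
  have IH2: "lin_chain (v ` {..<K}) ((2 * k + 1) * K) (y2 ` {..<K})"
    unfolding y2_def K(4)[symmetric]
    by (rule Suc.IH[of "- d"]) (use d shift in \<open>auto simp: em_def K field_simps\<close>)
  have half: "lin_chain ?F (card {..<K}) ((\<lambda>j x. 1 * f j x + e * f (j + K) x) ` {..<K})" for e
  proof (rule lin_chain_image)
    fix j assume "j \<in> {..<K}"
    then have "f j \<in> ?F" "f (j + K) \<in> ?F" by auto
    then show "\<exists>f'\<in>?F. \<exists>g\<in>?F. \<exists>a b. (\<lambda>x. 1 * f j x + e * f (j + K) x) = (\<lambda>x. a * f' x + b * g x)"
      by blast
  qed simp
  have "lin_chain ?F (card {..<K}) (u ` {..<K})" "lin_chain ?F (card {..<K}) (v ` {..<K})"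
    unfolding u_def v_def by (rule half)+
  then have "lin_chain ?F (card {..<K} + card {..<K}) (u ` {..<K} \<union> v ` {..<K})"
    by (rule lin_chain_union)
  then have uv: "lin_chain ?F (K + K) (u ` {..<K} \<union> v ` {..<K})" by simp
  have "lin_chain (u ` {..<K} \<union> v ` {..<K}) ((2 * k + 1) * K + (2 * k + 1) * K) (y1 ` {..<K} \<union> y2 ` {..<K})"
    by (intro lin_chain_union lin_chain_mono[OF IH1] lin_chain_mono[OF IH2]) auto
  then have y12: "lin_chain ?F (K + K + ((2 * k + 1) * K + (2 * k + 1) * K)) (y1 ` {..<K} \<union> y2 ` {..<K})"
    by (rule lin_chain_trans'[OF uv])
  have lo: "y i x = 1 / 2 * y1 i x + 1 / 2 * y2 i x" for i x
  proof -
    have "y i x = (\<Sum>j<K. \<epsilon> (int i - int j) * f j x + \<epsilon> (int i - int j - int K) * f (j + K) x)"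
      unfolding y_def sum_lessThan_add sum.distrib by (simp add: algebra_simps)
    also have "\<dots> = (\<Sum>j<K. 1 / 2 * (ep (int i - int j) * u j x) + 1 / 2 * (em (int i - int j) * v j x))"
      using d by (intro sum.cong refl) (simp add: ep_def em_def u_def v_def field_simps)
    finally show ?thesis by (simp add: y1_def y2_def sum.distrib sum_distrib_left)
  qed
  have hi: "y (i + K) x = 1 / (2 * d) * y1 i x + (- 1 / (2 * d)) * y2 i x" for i x
  proof -
    have "y (i + K) x = (\<Sum>j<K. \<epsilon> (int i - int j + int K) * f j x + \<epsilon> (int i - int j) * f (j + K) x)"
      unfolding y_def sum_lessThan_add sum.distrib by (simp add: algebra_simps)
    also have "\<dots> = (\<Sum>j<K. 1 / (2 * d) * (ep (int i - int j) * u j x)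
                      + (- 1 / (2 * d)) * (em (int i - int j) * v j x))"
    proof (intro sum.cong refl)
      fix j
      have "\<epsilon> (int i - int j - int K) = d * d * \<epsilon> (int i - int j + int K)"
        using per[of "int i - int j + int K"] by (simp add: algebra_simps)
      then show "\<epsilon> (int i - int j + int K) * f j x + \<epsilon> (int i - int j) * f (j + K) x =
          1 / (2 * d) * (ep (int i - int j) * u j x) + (- 1 / (2 * d)) * (em (int i - int j) * v j x)"
        using d(1) by (simp add: ep_def em_def u_def v_def field_simps)
    qed
    finally show ?thesis unfolding y1_def y2_def sum.distrib sum_distrib_left .
  qed
  have "lin_chain (?F \<union> (y1 ` {..<K} \<union> y2 ` {..<K})) (card {..<K + K}) (y ` {..<K + K})"
  proof (rule lin_chain_image)
    fix i assume i: "i \<in> {..<K + K}"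
    let ?G = "?F \<union> (y1 ` {..<K} \<union> y2 ` {..<K})"
    show "\<exists>f\<in>?G. \<exists>g\<in>?G. \<exists>a b. y i = (\<lambda>x. a * f x + b * g x)"
    proof (cases "i < K")
      case True
      then have "y1 i \<in> ?G" "y2 i \<in> ?G" by auto
      moreover have "y i = (\<lambda>x. 1 / 2 * y1 i x + 1 / 2 * y2 i x)" using lo by blast
      ultimately show ?thesis by blast
    next
      case False
      then have "y1 (i - K) \<in> ?G" "y2 (i - K) \<in> ?G" using i by auto
      moreover have "y i = (\<lambda>x. 1 / (2 * d) * y1 (i - K) x + (- 1 / (2 * d)) * y2 (i - K) x)"
        using hi[of "i - K"] False by auto
      ultimately show ?thesis by blast
    qed
  qed simp
  then have "lin_chain ?F (K + K + ((2 * k + 1) * K + (2 * k + 1) * K) + card {..<K + K}) (y ` {..<K + K})"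
    by (rule lin_chain_trans[OF y12])
  moreover have "K + K + ((2 * k + 1) * K + (2 * k + 1) * K) + card {..<K + K} = (2 * Suc k + 1) * (K + K)"
    by (simp add: algebra_simps)
  ultimately show ?case unfolding K(1) y_def by metis
qed

text \<open>Differences of indices below \<open>2^k\<close> lie strictly between \<open>-2^k\<close> and \<open>2^k\<close>, so \<open>\<gamma>\<close> may be continued
  periodically with period \<open>2^(k+1)\<close>; the input is padded with zeros, which explains the
  additional step.\<close>

lemma toeplitz_chain:
  fixes \<gamma> :: "int \<Rightarrow> complex" and f :: "nat \<Rightarrow> 'x \<Rightarrow> complex"
  assumes "0 < t" "t \<le> 2 ^ k" "r \<le> 2 ^ k"
  shows "lin_chain (f ` {..<t}) (1 + (2 * k + 3) * 2 ^ (k + 1))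
           ((\<lambda>i x. \<Sum>j<t. \<gamma> (int i - int j) * f j x) ` {..<r})"
proof -
  define K :: nat where "K = 2 ^ (k + 1)"
  define \<epsilon> where "\<epsilon> z = \<gamma> ((z + 2 ^ k) mod 2 ^ (k + 1) - 2 ^ k)" for z :: int
  define f' where "f' j = (if j < t then f j else (\<lambda>x. 0))" for j
  have tK: "t \<le> K" "r \<le> K" using assms by (simp_all add: K_def)
  have "lin_chain (f ` {..<t}) (card {0::nat}) ((\<lambda>i x. 0) ` {0::nat})"
    by (rule lin_chain_image_scaled) (use assms in \<open>auto intro!: bexI[of _ 0] exI[of _ 0]\<close>)
  then have zero: "lin_chain (f ` {..<t}) 1 (f' ` {..<K})"
    by (rule lin_chain_mono[OF lin_chain_keep]) (auto simp: f'_def)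
  have "lin_chain (f' ` {..<K}) ((2 * (k + 1) + 1) * K)
          ((\<lambda>i x. \<Sum>j<K. \<epsilon> (int i - int j) * f' j x) ` {..<K})"
    unfolding K_def
  proof (rule twisted_circulant_chain[of 1])
    fix z :: int
    have "(z - 2 ^ (k + 1) + 2 ^ k) mod 2 ^ (k + 1) = (z + 2 ^ k) mod 2 ^ (k + 1)"
      by (metis diff_add_eq minus_mod_self2)
    then show "\<epsilon> (z - 2 ^ (k + 1)) = 1 * \<epsilon> z" by (simp add: \<epsilon>_def)
  qed simp
  then have "lin_chain (f ` {..<t}) (1 + (2 * (k + 1) + 1) * K)
          ((\<lambda>i x. \<Sum>j<K. \<epsilon> (int i - int j) * f' j x) ` {..<K})"
    by (rule lin_chain_trans'[OF zero])
  moreover have "(\<lambda>x. \<Sum>j<K. \<epsilon> (int i - int j) * f' j x) = (\<lambda>x. \<Sum>j<t. \<gamma> (int i - int j) * f j x)"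
    if "i < r" for i
  proof
    fix x
    have "(\<Sum>j<K. \<epsilon> (int i - int j) * f' j x) = (\<Sum>j<t. \<epsilon> (int i - int j) * f' j x)"
      using tK by (intro sum.mono_neutral_right) (auto simp: f'_def)
    also have "\<dots> = (\<Sum>j<t. \<gamma> (int i - int j) * f j x)"
    proof (intro sum.cong refl)
      fix j assume j: "j \<in> {..<t}"
      have "i < 2 ^ k" "j < 2 ^ k" using that j assms by auto
      then have ij: "int i < 2 ^ k" "int j < 2 ^ k"
        by (metis of_nat_less_iff of_nat_numeral of_nat_power)+
      have "0 \<le> int i - int j + 2 ^ k" using ij by linarith
      moreover have "int i - int j + 2 ^ k < 2 ^ (k + 1)"
        using ij unfolding power_add power_one_right by linarith
      ultimately have "(int i - int j + 2 ^ k) mod 2 ^ (k + 1) = int i - int j + 2 ^ k"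
        by (rule mod_pos_pos_trivial)
      then show "\<epsilon> (int i - int j) * f' j x = \<gamma> (int i - int j) * f j x"
        using j by (simp add: \<epsilon>_def f'_def)
    qed
    finally show "(\<Sum>j<K. \<epsilon> (int i - int j) * f' j x) = (\<Sum>j<t. \<gamma> (int i - int j) * f j x)" .
  qed
  then have "(\<lambda>i x. \<Sum>j<t. \<gamma> (int i - int j) * f j x) ` {..<r}
      = (\<lambda>i x. \<Sum>j<K. \<epsilon> (int i - int j) * f' j x) ` {..<r}"
    by (intro image_cong) auto
  then have "(\<lambda>i x. \<Sum>j<t. \<gamma> (int i - int j) * f j x) ` {..<r}
      \<subseteq> (\<lambda>i x. \<Sum>j<K. \<epsilon> (int i - int j) * f' j x) ` {..<K}"
    using image_mono[of "{..<r}" "{..<K}"] tK(2) by simp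
  ultimately show ?thesis by (rule lin_chain_mono[OF _ order_refl]) (simp add: K_def algebra_simps)
qed

lemma chirp_chain:
  fixes \<alpha> \<beta> :: "nat \<Rightarrow> complex" and \<gamma> :: "int \<Rightarrow> complex" and f :: "nat \<Rightarrow> 'x \<Rightarrow> complex"
  assumes "0 < t" "t \<le> 2 ^ k" "r \<le> 2 ^ k"
  shows "lin_chain (f ` {..<t}) (t + (1 + (2 * k + 3) * 2 ^ (k + 1)) + r)
           ((\<lambda>i x. \<Sum>j<t. \<alpha> i * \<gamma> (int i - int j) * \<beta> j * f j x) ` {..<r})"
proof -
  define g where "g j = (\<lambda>x. \<beta> j * f j x)" for j
  define y where "y = (\<lambda>i x. \<Sum>j<t. \<gamma> (int i - int j) * g j x)"
  have "lin_chain (f ` {..<t}) (card {..<t}) (g ` {..<t})"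
    by (rule lin_chain_image_scaled) (auto simp: g_def)
  then have "lin_chain (f ` {..<t}) t (g ` {..<t})" by simp
  moreover have "lin_chain (f ` {..<t} \<union> g ` {..<t}) (1 + (2 * k + 3) * 2 ^ (k + 1)) (y ` {..<r})"
    unfolding y_def by (rule lin_chain_mono[OF toeplitz_chain[OF assms, of g \<gamma>]]) auto
  ultimately have "lin_chain (f ` {..<t}) (t + (1 + (2 * k + 3) * 2 ^ (k + 1))) (y ` {..<r})"
    by (rule lin_chain_trans)
  moreover have "lin_chain (f ` {..<t} \<union> y ` {..<r}) (card {..<r}) ((\<lambda>i x. \<alpha> i * y i x) ` {..<r})"
    by (rule lin_chain_image_scaled) auto
  ultimately have "lin_chain (f ` {..<t}) (t + (1 + (2 * k + 3) * 2 ^ (k + 1)) + card {..<r})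
      ((\<lambda>i x. \<alpha> i * y i x) ` {..<r})"
    by (rule lin_chain_trans)
  then show ?thesis by (simp add: y_def g_def sum_distrib_left mult.assoc)
qed

definition real_parts :: "('x \<Rightarrow> complex) set \<Rightarrow> ('x \<Rightarrow> real) set" where
  "real_parts F = (\<lambda>f x. Re (f x)) ` F \<union> (\<lambda>f x. Im (f x)) ` F"

lemma real_parts_insert:
  "real_parts (insert f F) = {\<lambda>x. Re (f x), \<lambda>x. Im (f x)} \<union> real_parts F"
  by (simp only: real_parts_def image_insert) blast

text \<open>A complex linear combination of two terms has real and imaginary parts that are real combinations
  of four terms, three steps each.\<close>

lemma lin_chain_real_parts: "lin_chain F c G \<Longrightarrow> lin_chain (real_parts F) (6 * c) (real_parts G)"
proof (induction rule: lin_chain.induct)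
  case (step f F g a b c G)
  let ?R = "real_parts F"
  have 1: "lin_chain ?R 3 {\<lambda>x. p * f1 x + q * f2 x + (r * f3 x + s * f4 x)}"
    if "f1 \<in> ?R" "f2 \<in> ?R" "f3 \<in> ?R" "f4 \<in> ?R" for p q r s f1 f2 f3 f4
  proof -
    let ?g1 = "\<lambda>x. p * f1 x + q * f2 x" and ?g2 = "\<lambda>x. r * f3 x + s * f4 x"
    have "lin_chain ?R (1 + 1) ({?g1} \<union> {?g2})"
      by (intro lin_chain_union lin_chain_single that)
    moreover have "lin_chain ({?g1} \<union> {?g2}) 1 {\<lambda>x. 1 * ?g1 x + 1 * ?g2 x}"
      by (rule lin_chain_single) auto
    ultimately have "lin_chain ?R (1 + 1 + 1) {\<lambda>x. 1 * ?g1 x + 1 * ?g2 x}"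
      by (rule lin_chain_trans')
    then show ?thesis by (simp add: numeral_3_eq_3)
  qed
  have parts: "(\<lambda>x. Re (f x)) \<in> ?R" "(\<lambda>x. Im (f x)) \<in> ?R" "(\<lambda>x. Re (g x)) \<in> ?R" "(\<lambda>x. Im (g x)) \<in> ?R"
    using step.hyps by (auto simp: real_parts_def)
  have "lin_chain ?R (3 + 3)
     ({\<lambda>x. Re a * Re (f x) + (- Im a) * Im (f x) + (Re b * Re (g x) + (- Im b) * Im (g x))} \<union>
      {\<lambda>x. Re a * Im (f x) + Im a * Re (f x) + (Re b * Im (g x) + Im b * Re (g x))})"
    by (intro lin_chain_union 1 parts)
  then have "lin_chain ?R 6 {\<lambda>x. Re (a * f x + b * g x), \<lambda>x. Im (a * f x + b * g x)}"
    by (simp add: insert_commute algebra_simps)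
  from lin_chain_trans[OF this] step.IH have "lin_chain ?R (6 + 6 * c) (real_parts G)"
    by (simp add: real_parts_insert Un_commute)
  then show ?case by simp
qed (auto intro!: lin_chain.stop simp: real_parts_def)

section \<open>Chains for matrices\<close>

definition lin_form :: "'k::field mat \<Rightarrow> nat \<Rightarrow> (nat \<Rightarrow> 'k) \<Rightarrow> 'k" where
  "lin_form A i x = (\<Sum>j<dim_col A. A $$ (i, j) * x j)"

definition coords :: "nat \<Rightarrow> ((nat \<Rightarrow> 'k) \<Rightarrow> 'k) set" where
  "coords n = (\<lambda>j x. x j) ` {..<n}"

text \<open>The functions here are the linear forms given by the rows, on sequences of which only an
  initial segment is used.\<close>

definition mat_chain :: "'k::field mat \<Rightarrow> nat \<Rightarrow> bool" where
  "mat_chain A c \<longleftrightarrow> lin_chain (coords (dim_col A)) c (lin_form A ` {..<dim_row A})"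

lemma mat_chain_mult:
  assumes A: "mat_chain A c" and B: "mat_chain B d" and dim: "dim_col A = dim_row B"
  shows "mat_chain (A * B) (d + c)"
proof -
  define \<phi> where "\<phi> x = (\<lambda>i. lin_form B i x)" for x
  have "lin_chain ((\<lambda>f. f \<circ> \<phi>) ` coords (dim_col A)) c ((\<lambda>f. f \<circ> \<phi>) ` lin_form A ` {..<dim_row A})"
    using A unfolding mat_chain_def by (rule lin_chain_comp)
  moreover have "(\<lambda>f. f \<circ> \<phi>) ` coords (dim_col A) = lin_form B ` {..<dim_row B}"
    by (auto simp: coords_def \<phi>_def o_def dim image_image)
  moreover have "lin_form A i \<circ> \<phi> = lin_form (A * B) i" if "i < dim_row A" for i
  proof
    fix x
    have "(lin_form A i \<circ> \<phi>) x = (\<Sum>k<dim_row B. \<Sum>j<dim_col B. A $$ (i, k) * B $$ (k, j) * x j)"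
      by (simp add: lin_form_def \<phi>_def dim sum_distrib_left mult.assoc)
    also have "\<dots> = (\<Sum>j<dim_col B. (\<Sum>k<dim_row B. A $$ (i, k) * B $$ (k, j)) * x j)"
      by (subst sum.swap) (simp add: sum_distrib_right)
    also have "\<dots> = lin_form (A * B) i x"
      using that dim by (auto simp: lin_form_def scalar_prod_def lessThan_atLeast0 intro!: sum.cong)
    finally show "(lin_form A i \<circ> \<phi>) x = lin_form (A * B) i x" .
  qed
  then have "(\<lambda>f. f \<circ> \<phi>) ` lin_form A ` {..<dim_row A} = lin_form (A * B) ` {..<dim_row (A * B)}"
    by (auto simp: image_image)
  ultimately have "lin_chain (lin_form B ` {..<dim_row B}) c (lin_form (A * B) ` {..<dim_row (A * B)})"
    by simp
  with B have "lin_chain (coords (dim_col B)) (d + c) (lin_form (A * B) ` {..<dim_row (A * B)})"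
    unfolding mat_chain_def by (rule lin_chain_trans')
  then show ?thesis by (simp add: mat_chain_def)
qed

lemma mat_chain_four_block_diag:
  assumes A: "mat_chain A c" and D: "mat_chain D d"
  shows "mat_chain (four_block_mat A (0\<^sub>m (dim_row A) (dim_col D)) (0\<^sub>m (dim_row D) (dim_col A)) D) (c + d)"
    (is "mat_chain ?M _")
proof -
  define \<phi> where "\<phi> x = (\<lambda>i. x (dim_col A + i))" for x :: "nat \<Rightarrow> 'a"
  have "lin_chain ((\<lambda>f. f \<circ> \<phi>) ` coords (dim_col D)) d ((\<lambda>f. f \<circ> \<phi>) ` lin_form D ` {..<dim_row D})"
    using D unfolding mat_chain_def by (rule lin_chain_comp)
  moreover have "(\<lambda>f. f \<circ> \<phi>) ` coords (dim_col D) \<subseteq> coords (dim_col ?M)"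
    by (auto simp: coords_def \<phi>_def o_def image_image)
  ultimately have D': "lin_chain (coords (dim_col ?M)) d ((\<lambda>f. f \<circ> \<phi>) ` lin_form D ` {..<dim_row D})"
    by (rule lin_chain_mono) auto
  have A': "lin_chain (coords (dim_col ?M)) c (lin_form A ` {..<dim_row A})"
    by (rule lin_chain_mono[OF A[unfolded mat_chain_def]]) (auto simp: coords_def)
  have top: "lin_form ?M i = lin_form A i" if "i < dim_row A" for i
    using that by (auto simp: fun_eq_iff lin_form_def sum_lessThan_add)
  have bottom: "lin_form ?M i = lin_form D (i - dim_row A) \<circ> \<phi>"
    if "\<not> i < dim_row A" "i < dim_row A + dim_row D" for i
    using that by (auto simp: fun_eq_iff lin_form_def sum_lessThan_add \<phi>_def)
  have "lin_form ?M ` {..<dim_row ?M} \<subseteq> lin_form A ` {..<dim_row A} \<union> (\<lambda>f. f \<circ> \<phi>) ` lin_form D ` {..<dim_row D}"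
  proof
    fix g assume "g \<in> lin_form ?M ` {..<dim_row ?M}"
    then obtain i where i: "i < dim_row A + dim_row D" "g = lin_form ?M i" by auto
    show "g \<in> lin_form A ` {..<dim_row A} \<union> (\<lambda>f. f \<circ> \<phi>) ` lin_form D ` {..<dim_row D}"
    proof (cases "i < dim_row A")
      case False
      then have "i - dim_row A < dim_row D" using i by simp
      with bottom[OF False i(1)] i(2) show ?thesis by blast
    qed (use top i in auto)
  qed
  then show ?thesis unfolding mat_chain_def
    by (rule lin_chain_mono[OF lin_chain_union[OF A' D'] order_refl]) simp
qed

lemma mat_chain_diag_block:
  assumes "list_all2 mat_chain As cs"
  shows "mat_chain (diag_block_mat As) (sum_list cs)"
  using assms
proof (induction rule: list_all2_induct)
  case Nil
  then show ?case by (auto simp: mat_chain_def intro: lin_chain.stop)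
next
  case (Cons A As c cs)
  then show ?case by (simp add: Let_def mat_chain_four_block_diag)
qed

text \<open>Reading an input is free, because available functions need not be copied.\<close>

lemma mat_chain_selection:
  fixes A :: "'k::field mat"
  assumes "\<And>i. i < dim_row A \<Longrightarrow> \<sigma> i < dim_col A"
    and "\<And>i j. i < dim_row A \<Longrightarrow> j < dim_col A \<Longrightarrow> A $$ (i, j) = (if j = \<sigma> i then 1 else 0)"
  shows "mat_chain A 0"
proof -
  have "lin_form A i = (\<lambda>x. x (\<sigma> i))" if "i < dim_row A" for i
  proof
    fix x
    have "lin_form A i x = (\<Sum>j<dim_col A. if j = \<sigma> i then x j else 0)"
      unfolding lin_form_def by (rule sum.cong) (use assms that in auto)
    then show "lin_form A i x = x (\<sigma> i)" using assms(1)[OF that] by simp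
  qed
  then show ?thesis
    using assms(1) by (auto simp: mat_chain_def coords_def intro!: lin_chain.stop)
qed

lemma mat_chain_diagonal:
  assumes "A \<in> carrier_mat n n" "diagonal_mat A"
  shows "mat_chain A n"
proof -
  have "lin_form A i = (\<lambda>x. A $$ (i, i) * x i)" if "i < n" for i
  proof
    fix x
    have "lin_form A i x = (\<Sum>j<n. if j = i then A $$ (i, j) * x j else 0)"
      unfolding lin_form_def using assms that by (intro sum.cong) (auto simp: diagonal_mat_def)
    then show "lin_form A i x = A $$ (i, i) * x i" using that by simp
  qed
  then have "lin_chain (coords n) (card {..<n}) (lin_form A ` {..<n})"
    by (intro lin_chain_image_scaled) (auto simp: coords_def)
  then show ?thesis using assms by (simp add: mat_chain_def)
qed

text \<open>Multiplication by a complex chirp matrix costs a scaling, a Toeplitz product and another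
  scaling; the real input is embedded into the complex numbers and the imaginary part is taken
  at the end.\<close>

lemma mat_chain_chirp:
  assumes "0 < t" "t \<le> 2 ^ k" "r \<le> 2 ^ k"
  shows "mat_chain (mat r t (\<lambda>(i, j). Im (\<alpha> i * \<gamma> (int i - int j) * \<beta> j))) ((24 * k + 55) * 2 ^ k)"
    (is "mat_chain ?M _")
proof -
  define f where "f j = (\<lambda>x. complex_of_real (x j))" for j :: nat
  define y where "y = (\<lambda>i x. \<Sum>j<t. \<alpha> i * \<gamma> (int i - int j) * \<beta> j * f j x)"
  have "lin_chain (coords t) (card {0::nat}) ((\<lambda>i x. 0) ` {0::nat})"
    by (rule lin_chain_image_scaled) (use assms in \<open>auto simp: coords_def intro!: bexI[of _ 0] exI[of _ 0]\<close>)
  then have "lin_chain (coords t) 1 (real_parts (f ` {..<t}))"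
    by (rule lin_chain_mono[OF lin_chain_keep]) (auto simp: real_parts_def f_def coords_def)
  moreover have "lin_chain (real_parts (f ` {..<t})) (6 * (t + (1 + (2 * k + 3) * 2 ^ (k + 1)) + r))
      (real_parts (y ` {..<r}))"
    unfolding y_def by (intro lin_chain_real_parts chirp_chain assms)
  ultimately have chain: "lin_chain (coords t) (1 + 6 * (t + (1 + (2 * k + 3) * 2 ^ (k + 1)) + r))
      (real_parts (y ` {..<r}))"
    by (rule lin_chain_trans')
  have "lin_form ?M i = (\<lambda>x. Im (y i x))" if "i < r" for i
    using that by (auto simp: lin_form_def y_def f_def intro!: ext sum.cong)
  then have sub: "lin_form ?M ` {..<r} \<subseteq> real_parts (y ` {..<r})"
    by (auto simp: real_parts_def)
  have le: "1 + 6 * (t + (1 + (2 * k + 3) * 2 ^ (k + 1)) + r) \<le> (24 * k + 55) * 2 ^ k"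
  proof -
    have "1 + 6 * (t + (1 + (2 * k + 3) * 2 ^ (k + 1)) + r) \<le> 1 + 6 * (2 ^ k + (1 + (2 * k + 3) * 2 ^ (k + 1)) + 2 ^ k)"
      using assms by (intro add_mono mult_le_mono) auto
    also have "\<dots> = (24 * k + 48) * 2 ^ k + 7" by (simp add: algebra_simps)
    also have "\<dots> \<le> (24 * k + 55) * 2 ^ k" by (simp add: algebra_simps)
    finally show ?thesis by simp
  qed
  show ?thesis using lin_chain_mono[OF chain order_refl sub le] by (simp add: mat_chain_def)
qed

section \<open>From chains to programs\<close>

text \<open>One step of a chain becomes two scalings and an addition. The addresses of the available functions
  must not depend on the input, therefore the memory is a function of the input \<open>x\<close>.\<close>

lemma lin_chain_program:
  fixes M :: "'x \<Rightarrow> real list"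
  assumes "lin_chain F c G" "\<And>x. length (M x) = L" "\<And>f. f \<in> F \<Longrightarrow> \<exists>i<L. \<forall>x. M x ! i = f x"
  shows "\<exists>p. length p \<le> 3 * c \<and> (\<forall>x. length (fold exec p (M x)) = L + length p) \<and>
           (\<forall>g\<in>G. \<exists>i<L + length p. \<forall>x. fold exec p (M x) ! i = g x)"
  using assms
proof (induction arbitrary: M L rule: lin_chain.induct)
  case (stop G F c)
  then show ?case by (intro exI[of _ "[]"]) auto
next
  case (step f F g a b c G)
  obtain i j where i: "i < L" "\<And>x. M x ! i = f x" and j: "j < L" "\<And>x. M x ! j = g x"
    using step.prems(2) step.hyps by metis
  define q where "q = [Scale a i, Scale b j, instr.Add L (L + 1)]"
  have q: "fold exec q (M x) = M x @ [a * f x, b * g x, a * f x + b * g x]" for x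
    using i j step.prems(1)[of x] by (simp add: q_def cell_def nth_append)
  have "\<exists>p. length p \<le> 3 * c \<and>
      (\<forall>x. length (fold exec p (fold exec q (M x))) = (L + 3) + length p) \<and>
      (\<forall>g\<in>G. \<exists>i<(L + 3) + length p. \<forall>x. fold exec p (fold exec q (M x)) ! i = g x)"
  proof (rule step.IH)
    fix h assume "h \<in> insert (\<lambda>x. a * f x + b * g x) F"
    then consider "h = (\<lambda>x. a * f x + b * g x)" | "h \<in> F" by blast
    then show "\<exists>i<L + 3. \<forall>x. fold exec q (M x) ! i = h x"
    proof cases
      case 1
      then show ?thesis using step.prems(1) by (auto simp: q nth_append intro!: exI[of _ "L + 2"])
    next
      case 2
      then obtain l where "l < L" "\<forall>x. M x ! l = h x" using step.prems(2) by blast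
      then show ?thesis using step.prems(1) by (auto simp: q nth_append intro!: exI[of _ l])
    qed
  qed (simp add: q step.prems)
  then obtain p where p: "length p \<le> 3 * c"
      "\<forall>x. length (fold exec p (fold exec q (M x))) = (L + 3) + length p"
      "\<forall>g\<in>G. \<exists>i<(L + 3) + length p. \<forall>x. fold exec p (fold exec q (M x)) ! i = g x" by blast
  have "length q = 3" by (simp add: q_def)
  with p show ?case by (intro exI[of _ "q @ p"]) (auto simp: add.assoc)
qed

lemma fold_exec_copy:
  assumes "\<forall>i\<in>set is. i < length mem"
  shows "fold exec (map (Scale 1) is) mem = mem @ map ((!) mem) is"
  using assms
proof (induction "is" arbitrary: mem)
  case (Cons i "is")
  have "fold exec (map (Scale 1) is) (mem @ [mem ! i])
      = (mem @ [mem ! i]) @ map ((!) (mem @ [mem ! i])) is"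
    using Cons.prems by (intro Cons.IH) auto
  moreover have "map ((!) (mem @ [mem ! i])) is = map ((!) mem) is"
    using Cons.prems by (auto simp: nth_append)
  ultimately show ?case using Cons.prems by (simp add: cell_def)
qed simp

text \<open>The final copies put the outputs into the last cells in the right order.\<close>

lemma mat_chain_computes:
  assumes "mat_chain A c"
  shows "\<exists>p. computes p A \<and> length p \<le> 3 * c + dim_row A"
proof -
  let ?r = "dim_row A" and ?n = "dim_col A"
  define M where "M = (\<lambda>x :: nat \<Rightarrow> real. map x [0..<?n])"
  have "\<exists>p. length p \<le> 3 * c \<and> (\<forall>x. length (fold exec p (M x)) = ?n + length p) \<and>
           (\<forall>g\<in>lin_form A ` {..<?r}. \<exists>i<?n + length p. \<forall>x. fold exec p (M x) ! i = g x)"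
    by (rule lin_chain_program[OF assms[unfolded mat_chain_def]]) (auto simp: M_def coords_def)
  then obtain p where p: "length p \<le> 3 * c" "\<And>x. length (fold exec p (M x)) = ?n + length p"
      "\<And>k. k < ?r \<Longrightarrow> \<exists>i<?n + length p. \<forall>x. fold exec p (M x) ! i = lin_form A k x" by auto
  then obtain a where a: "\<And>k. k < ?r \<Longrightarrow> a k < ?n + length p"
      "\<And>k x. k < ?r \<Longrightarrow> fold exec p (M x) ! a k = lin_form A k x" by metis
  define q where "q = p @ map (Scale 1) (map a [0..<?r])"
  have "computes q A" unfolding computes_def Let_def
  proof
    fix v :: "real vec" assume v: "v \<in> carrier_vec ?n"
    define x where "x = (\<lambda>j. v $ j)"
    have inp: "list_of_vec v = M x" using v by (auto intro!: nth_equalityI simp: M_def x_def list_of_vec_index)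
    have out: "list_of_vec (A *\<^sub>v v) = map (\<lambda>k. lin_form A k x) [0..<?r]"
      using v by (auto intro!: nth_equalityI sum.cong
          simp: list_of_vec_index lin_form_def x_def scalar_prod_def lessThan_atLeast0)
    have "fold exec q (M x) = fold exec p (M x) @ map ((!) (fold exec p (M x))) (map a [0..<?r])"
      unfolding q_def fold_append comp_apply by (rule fold_exec_copy) (auto simp: p(2) a(1))
    also have "map ((!) (fold exec p (M x))) (map a [0..<?r]) = map (\<lambda>k. lin_form A k x) [0..<?r]"
      by (auto simp: a(2))
    finally show "?r \<le> length (fold exec q (list_of_vec v)) \<and>
        drop (length (fold exec q (list_of_vec v)) - ?r) (fold exec q (list_of_vec v)) = list_of_vec (A *\<^sub>v v)"
      by (simp add: inp out)
  qed
  moreover have "length q \<le> 3 * c + ?r" using p(1) by (simp add: q_def)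
  ultimately show ?thesis by blast
qed

section \<open>Costs of the factors\<close>

lemma mat_chain_match_mat:
  assumes "distinct ys" "set us \<subseteq> set ys"
  shows "mat_chain (match_mat us ys) 0"
proof -
  have "\<exists>k<length ys. ys ! k = us ! i" if "i < length us" for i
    using assms(2) that by (metis in_set_conv_nth nth_mem subsetD)
  then obtain \<sigma> where \<sigma>: "\<And>i. i < length us \<Longrightarrow> \<sigma> i < length ys" "\<And>i. i < length us \<Longrightarrow> ys ! \<sigma> i = us ! i"
    by metis
  show ?thesis
  proof (rule mat_chain_selection)
    fix i j assume ij: "i < dim_row (match_mat us ys)" "j < dim_col (match_mat us ys)"
    then have "us ! i = ys ! j \<longleftrightarrow> j = \<sigma> i"
      using \<sigma>[of i] assms(1) by (auto simp: nth_eq_iff_index_eq simp flip: \<sigma>(2))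
    then show "match_mat us ys $$ (i, j) = (if j = \<sigma> i then 1 else 0)"
      using ij by (simp add: kernel_mat_def)
  qed (simp add: \<sigma>)
qed

lemma mat_chain_diag_block_le:
  assumes "\<And>A. A \<in> set As \<Longrightarrow> mat_chain A b"
  shows "mat_chain (diag_block_mat As) (length As * b)"
proof -
  have "list_all2 mat_chain As (replicate (length As) b)"
    using assms by (simp add: list_all2_conv_all_nth)
  from mat_chain_diag_block[OF this] show ?thesis by (simp add: sum_list_replicate)
qed

lemma mat_chain_kron_one: "mat_chain A b \<Longrightarrow> mat_chain (kron (1\<^sub>m k) A) (k * b)"
  unfolding kron_one using mat_chain_diag_block_le[of "replicate k A" b] by auto

lemma mat_chain_one: "mat_chain (1\<^sub>m k) 0"
  by (rule mat_chain_selection[where \<sigma> = "\<lambda>i. i"]) auto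

lemma mat_chain_H_blk: "mat_chain (H_blk s) 0"
  by (rule mat_chain_selection[where \<sigma> = "\<lambda>i. i div 2"]) (auto simp: H_blk_def)

text \<open>Steps for a sine transform whose input and output have length at most \<open>2^k\<close>.\<close>

definition sine_cost :: "nat \<Rightarrow> nat" where
  "sine_cost k = (24 * k + 55) * 2 ^ k"

lemma Im_cis_triple: "Im (of_real c * cis x * cis y * cis z) = c * sin (x + y + z)"
  by (simp add: cis_mult mult.assoc)

text \<open>The phase is \<open>2\<theta>xy\<close> with \<open>x = i + 1/2\<close>, \<open>y = j + 1\<close> and \<open>\<theta> = \<pi> / (2(t + 1))\<close>, and
  \<open>x - y = i - j - 1/2\<close> depends on \<open>i - j\<close> only.\<close>

lemma mat_chain_U_plus:
  assumes "0 < t" "t + 1 \<le> 2 ^ k"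
  shows "mat_chain (U_plus t) (sine_cost k)"
proof -
  define c \<theta> where "c = sqrt (2 / (real t + 1))" and "\<theta> = pi / (2 * (real t + 1))"
  have "U_plus t = mat (t + 1) t (\<lambda>(i, j). Im ((of_real c * cis (\<theta> * (real i + 1 / 2) ^ 2))
      * cis (- (\<theta> * (of_int (int i - int j) - 1 / 2) ^ 2)) * cis (\<theta> * (real j + 1) ^ 2)))"
  proof (rule eq_matI, goal_cases)
    case (1 i j)
    then have ij: "i < t + 1" "j < t" by auto
    have "(real i + 1 / 2) ^ 2 - (real i - real j - 1 / 2) ^ 2 + (real j + 1) ^ 2 = 2 * ((real j + 1) * (real i + 1 / 2))"
      by (simp add: power2_eq_square algebra_simps)
    then have "\<theta> * (real i + 1 / 2) ^ 2 + - (\<theta> * (real i - real j - 1 / 2) ^ 2) + \<theta> * (real j + 1) ^ 2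
        = \<theta> * (2 * ((real j + 1) * (real i + 1 / 2)))"
      by (metis add.commute add_uminus_conv_diff distrib_left mult_minus_right)
    also have "\<dots> = real (j + 1) * pi * (real i + 1 / 2) / (real t + 1)"
      by (simp add: \<theta>_def field_simps)
    finally show ?case using ij by (simp only: index_mat prod.case Im_cis_triple) (simp add: U_plus_def c_def)
  qed (simp_all add: U_plus_def)
  moreover have "mat_chain (mat (t + 1) t (\<lambda>(i, j). Im ((of_real c * cis (\<theta> * (real i + 1 / 2) ^ 2))
      * cis (- (\<theta> * (of_int (int i - int j) - 1 / 2) ^ 2)) * cis (\<theta> * (real j + 1) ^ 2)))) (sine_cost k)"
    unfolding sine_cost_def
    by (rule mat_chain_chirp[where \<gamma> = "\<lambda>d. cis (- (\<theta> * (of_int d - 1 / 2) ^ 2))"]) (use assms in auto)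
  ultimately show ?thesis by simp
qed

lemma mat_chain_V_plus:
  assumes "0 < t" "t \<le> 2 ^ k"
  shows "mat_chain (V_plus t) (sine_cost k)"
proof -
  define c \<theta> where "c = sqrt (2 / (real t + 1))" and "\<theta> = pi / (2 * (real t + 1))"
  have "V_plus t = mat t t (\<lambda>(i, j). Im ((of_real c * cis (\<theta> * (real i + 1) ^ 2))
      * cis (- (\<theta> * of_int (int i - int j) ^ 2)) * cis (\<theta> * (real j + 1) ^ 2)))"
  proof (rule eq_matI, goal_cases)
    case (1 i j)
    then have ij: "i < t" "j < t" by auto
    have "(real i + 1) ^ 2 - (real i - real j) ^ 2 + (real j + 1) ^ 2 = 2 * ((real j + 1) * (real i + 1))"
      by (simp add: power2_eq_square algebra_simps)
    then have "\<theta> * (real i + 1) ^ 2 + - (\<theta> * (real i - real j) ^ 2) + \<theta> * (real j + 1) ^ 2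
        = \<theta> * (2 * ((real j + 1) * (real i + 1)))"
      by (metis add.commute add_uminus_conv_diff distrib_left mult_minus_right)
    also have "\<dots> = real (j + 1) * pi * (real i + 1) / (real t + 1)"
      by (simp add: \<theta>_def field_simps)
    finally show ?case using ij by (simp only: index_mat prod.case Im_cis_triple) (simp add: V_plus_def c_def)
  qed (simp_all add: V_plus_def)
  moreover have "mat_chain (mat t t (\<lambda>(i, j). Im ((of_real c * cis (\<theta> * (real i + 1) ^ 2))
      * cis (- (\<theta> * of_int (int i - int j) ^ 2)) * cis (\<theta> * (real j + 1) ^ 2)))) (sine_cost k)"
    unfolding sine_cost_def
    by (rule mat_chain_chirp[where \<gamma> = "\<lambda>d. cis (- (\<theta> * of_int d ^ 2))"]) (use assms in auto)
  ultimately show ?thesis by simp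
qed

text \<open>All sine transforms have \<open>2N\<close> inputs and at most \<open>2N + 1\<close> outputs, where \<open>N = 2^n\<close>; the power of
  two \<open>4N\<close> has room for them.\<close>

lemma pow_bounds: "0 < 2 * (2::nat) ^ n" "2 * (2::nat) ^ n \<le> 2 ^ (n + 2)" "2 * (2::nat) ^ n + 1 \<le> 2 ^ (n + 2)"
proof -
  have "1 \<le> (2::nat) ^ n" by simp
  then show "0 < 2 * (2::nat) ^ n" "2 * (2::nat) ^ n \<le> 2 ^ (n + 2)" "2 * (2::nat) ^ n + 1 \<le> 2 ^ (n + 2)"
    by (simp_all add: power_add)
qed

lemma mat_chain_U_blk: "mat_chain (U_blk (2 ^ n + s) s) (sine_cost (n + 2))"
proof -
  have "mat_chain (U_plus (2 * (2 ^ n + s - s))) (sine_cost (n + 2))"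
    using mat_chain_U_plus[OF pow_bounds(1,3)] by simp
  then have "list_all2 mat_chain [H_blk s, U_plus (2 * (2 ^ n + s - s)), H_blk s] [0, sine_cost (n + 2), 0]"
    by (simp add: mat_chain_H_blk)
  from mat_chain_diag_block[OF this] show ?thesis by (simp add: U_blk_def)
qed

lemma mat_chain_V_blk: "mat_chain (V_blk (2 ^ n + s) s) (sine_cost (n + 2))"
proof -
  have "mat_chain (V_plus (2 * (2 ^ n + s - s))) (sine_cost (n + 2))"
    using mat_chain_V_plus[OF pow_bounds(1,2)] by simp
  then have "list_all2 mat_chain [1\<^sub>m s, V_plus (2 * (2 ^ n + s - s)), 1\<^sub>m s] [0, sine_cost (n + 2), 0]"
    by (simp add: mat_chain_one)
  from mat_chain_diag_block[OF this] show ?thesis by (simp add: V_blk_def)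
qed

lemma length_block_indices: "m \<le> n \<Longrightarrow> 0 < m \<Longrightarrow> 2 * length (block_indices n m) = 2 ^ n"
  by (simp add: block_indices_def length_product flip: power_add power_Suc)

lemma mat_chain_level:
  assumes "\<And>s. mat_chain (B (2 ^ n + s) s) b"
  shows "mat_chain (level_diag B n m) (length (block_indices n m) * b)"
proof -
  have "mat_chain (level_diag B n m) (length (map (\<lambda>(l, s). B (2 ^ n + s) s) (block_indices n m)) * b)"
    unfolding level_diag_blocks by (rule mat_chain_diag_block_le) (use assms in auto)
  then show ?thesis by simp
qed

lemma mat_chain_normalize_cols:
  assumes "mat_chain A c"
  shows "mat_chain (normalize_cols A) (dim_col A + c)"
proof -
  define D where "D = mat (dim_col A) (dim_col A) (\<lambda>(i, j). if i = j then 1 / col_norm A j else 0)"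
  have D: "D \<in> carrier_mat (dim_col A) (dim_col A)" "diagonal_mat D"
    by (simp_all add: D_def diagonal_mat_def)
  have "A * D = normalize_cols A"
  proof (rule eq_matI)
    fix i j assume ij: "i < dim_row (normalize_cols A)" "j < dim_col (normalize_cols A)"
    then have "(A * D) $$ (i, j) = A $$ (i, j) * D $$ (j, j)"
      by (intro mult_diagonal_index[OF D]) (auto simp: normalize_cols_def)
    then show "(A * D) $$ (i, j) = normalize_cols A $$ (i, j)"
      using ij by (simp add: D_def normalize_cols_def)
  qed (simp_all add: normalize_cols_def D_def)
  moreover have "mat_chain (A * D) (dim_col A + c)"
    using mat_chain_mult[OF assms mat_chain_diagonal[OF D]] D by simp
  ultimately show ?thesis by simp
qed

lemma card_E_le: "m \<le> n \<Longrightarrow> card (E n m) \<le> 2 * 2 ^ n * 2 ^ n"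
proof -
  assume "m \<le> n"
  have "E n m \<subseteq> {- (2 ^ n)..<2 ^ n} \<times> {..<2 ^ n}"
  proof
    fix x assume "x \<in> E n m"
    then obtain h s where x: "x = (h, s)" "s < 2 ^ n" "- int (s mod 2 ^ m) \<le> h" "h < 2 ^ n"
      by (auto simp: E_def)
    have "s mod 2 ^ m \<le> 2 ^ m" by (simp add: less_imp_le)
    also have "(2::nat) ^ m \<le> 2 ^ n" using \<open>m \<le> n\<close> by simp
    finally have "int (s mod 2 ^ m) \<le> 2 ^ n" by (metis of_nat_le_iff of_nat_numeral of_nat_power)
    then have "- (2 ^ n) \<le> h" using x(3) by linarith
    then show "x \<in> {- (2 ^ n)..<2 ^ n} \<times> {..<2 ^ n}" using x by auto
  qed
  then have "card (E n m) \<le> card ({- (2 ^ n)..<2 ^ n :: int} \<times> {..<2 ^ n :: nat})"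
    by (intro card_mono) auto
  also have "\<dots> = nat (2 * 2 ^ n) * 2 ^ n" by (simp add: card_cartesian_product)
  also have "nat (2 * 2 ^ n) = 2 * 2 ^ n" by (simp add: nat_mult_distrib nat_power_eq)
  finally show ?thesis .
qed

text \<open>The summand \<open>16 N\<^sup>2\<close> leaves room for two diagonal factors of size at most \<open>8 N\<^sup>2\<close>
  each.\<close>

lemma program_of_mat_chain:
  assumes "mat_chain A c" "c \<le> 2 * 2 ^ n * sine_cost (n + 2) + 16 * (2 ^ n * 2 ^ n)"
    and "dim_row A \<le> 8 * (2 ^ n * 2 ^ n)" "2 \<le> n"
  shows "\<exists>p. computes p A \<and> real (length p) \<le> 1840 * (2 ^ n) ^ 2 * log 2 (2 ^ n)"
proof -
  obtain p where p: "computes p A" "length p \<le> 3 * c + dim_row A"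
    using mat_chain_computes[OF assms(1)] by blast
  have "length p \<le> 3 * (2 * 2 ^ n * sine_cost (n + 2) + 16 * (2 ^ n * 2 ^ n)) + 8 * (2 ^ n * 2 ^ n)"
    by (rule order_trans[OF p(2) add_mono[OF mult_le_mono2[OF assms(2)] assms(3)]])
  also have "\<dots> = (576 * n + 2528) * (2 ^ n * 2 ^ n)"
    by (simp add: sine_cost_def power_add algebra_simps)
  also have "\<dots> \<le> (1840 * n) * (2 ^ n * 2 ^ n)"
    using assms(4) by (intro mult_right_mono) auto
  finally have "real (length p) \<le> real (1840 * n * (2 ^ n * 2 ^ n))" by (rule of_nat_mono)
  also have "\<dots> = 1840 * (2 ^ n) ^ 2 * log 2 (2 ^ n)"
    by (simp add: power2_eq_square log_nat_power)
  finally show ?thesis using p(1) by blast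
qed

context
  fixes n m :: nat
  assumes m: "0 < m" "m \<le> n"
begin

lemma mat_chain_Q_mat: "mat_chain (Q_mat n m) 0"
  unfolding Q_mat_eq[OF m]
  by (rule mat_chain_match_mat[OF distinct_out_order[OF m]]) (simp add: set_E_list set_out_order[OF m])

lemma mat_chain_P_mat: "mat_chain (P_mat n m) 0"
  unfolding P_mat_eq[OF m]
  by (rule mat_chain_match_mat[OF distinct_E_list]) (simp add: set_E_list set_in_order[OF m])

lemma mat_chain_P_mat_transpose: "mat_chain (transpose_mat (P_mat n m)) 0"
  unfolding P_mat_eq[OF m] transpose_match_mat
  by (rule mat_chain_match_mat[OF distinct_in_order[OF m]]) (simp add: set_E_list set_in_order[OF m])

text \<open>Each of the four quadrants contains \<open>N / 2\<close> blocks.\<close>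

lemma four_levels: "4 * (length (block_indices n m) * b) = 2 * 2 ^ n * b"
  using length_block_indices[OF m(2,1)] by (metis mult.assoc mult_2 numeral_Bit0 mult.commute distrib_right)

lemma mat_chain_U_full: "mat_chain (U_full n m) (2 * 2 ^ n * sine_cost (n + 2))"
  using mat_chain_kron_one[OF mat_chain_mult[OF mat_chain_Q_mat mat_chain_level[of U_blk n _ m, OF mat_chain_U_blk]], of 4]
    Q_mat_carrier[of n m] level_U_carrier[OF m]
  by (simp add: U_full_def four_levels)

lemma mat_chain_V_full: "mat_chain (V_full n m) (2 * 2 ^ n * sine_cost (n + 2))"
  using mat_chain_kron_one[OF mat_chain_mult[OF mat_chain_P_mat_transpose
      mat_chain_level[of V_blk n _ m, OF mat_chain_V_blk]], of 4]
    P_mat_carrier[of n m] level_V_carrier[OF m]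
  by (simp add: V_full_def four_levels)

lemma mat_chain_V_full_transpose: "mat_chain (transpose_mat (V_full n m)) (2 * 2 ^ n * sine_cost (n + 2))"
proof -
  have "transpose_mat (transpose_mat (P_mat n m) * level_diag V_blk n m) = level_diag V_blk n m * P_mat n m"
    using P_mat_carrier[of n m] level_V_carrier[OF m]
    by (subst transpose_mult[of _ "card (E n (m - 1))" "card (E n (m - 1))" _ "card (E n (m - 1))"])
       (auto simp: level_V_symmetric)
  then show ?thesis
    using mat_chain_kron_one[OF mat_chain_mult[OF mat_chain_level[of V_blk n _ m, OF mat_chain_V_blk] mat_chain_P_mat], of 4]
      P_mat_carrier[of n m] level_V_carrier[OF m]
    by (simp add: V_full_def kron_one_transpose four_levels)
qed

lemma mat_chain_Sigma_full: "mat_chain (Sigma_full n m) (4 * card (E n (m - 1)))"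
proof (rule mat_chain_diagonal)
  have "diag_with (\<lambda>x. 0 \<le> x) (Sigma_full n m)"
    unfolding Sigma_full_def kron_one by (rule diag_with_diag_block) (simp add: level_Sigma_diag)
  then show "diagonal_mat (Sigma_full n m)" by (simp add: diag_with_def)
qed (rule full_carriers[OF m])

lemma mat_chain_scaled_Sigma:
  "mat_chain (col_norms (U_full n m) * Sigma_full n m) (4 * card (E n (m - 1)) + 4 * card (E n (m - 1)))"
proof (rule mat_chain_mult[OF _ mat_chain_Sigma_full])
  show "mat_chain (col_norms (U_full n m)) (4 * card (E n (m - 1)))"
    using full_carriers(1)[OF m]
    by (intro mat_chain_diagonal) (auto simp: col_norms_def diagonal_mat_def)
qed (use full_carriers[OF m] in \<open>auto simp: col_norms_def\<close>)

lemma full_programs: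
  assumes "2 \<le> n"
    and "M \<in> {U_full n m, Sigma_full n m, V_full n m, transpose_mat (V_full n m),
            normalize_cols (U_full n m), col_norms (U_full n m) * Sigma_full n m}"
  shows "\<exists>p. computes p M \<and> real (length p) \<le> 1840 * (2 ^ n) ^ 2 * log 2 (2 ^ n)"
proof -
  have E: "card (E n m) \<le> 2 * (2 ^ n * 2 ^ n)" "card (E n (m - 1)) \<le> 2 * (2 ^ n * 2 ^ n)"
    using card_E_le[of m n] card_E_le[of "m - 1" n] m by (simp_all add: mult.assoc)
  note dims = full_carriers[OF m, THEN carrier_matD(1)] full_carriers[OF m, THEN carrier_matD(2)]
  have "dim_row M \<le> 8 * (2 ^ n * 2 ^ n)"
    using assms(2) dims E by (auto simp: normalize_cols_def col_norms_def)
  moreover have "\<exists>c. mat_chain M c \<and> c \<le> 2 * 2 ^ n * sine_cost (n + 2) + 16 * (2 ^ n * 2 ^ n)"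
    using assms(2)
  proof (elim insertE emptyE; hypsubst)
    show "\<exists>c. mat_chain (U_full n m) c \<and> c \<le> 2 * 2 ^ n * sine_cost (n + 2) + 16 * (2 ^ n * 2 ^ n)"
      using mat_chain_U_full by (intro exI conjI) auto
    show "\<exists>c. mat_chain (Sigma_full n m) c \<and> c \<le> 2 * 2 ^ n * sine_cost (n + 2) + 16 * (2 ^ n * 2 ^ n)"
      using mat_chain_Sigma_full E by (intro exI conjI) auto
    show "\<exists>c. mat_chain (V_full n m) c \<and> c \<le> 2 * 2 ^ n * sine_cost (n + 2) + 16 * (2 ^ n * 2 ^ n)"
      using mat_chain_V_full by (intro exI conjI) auto
    show "\<exists>c. mat_chain (transpose_mat (V_full n m)) c \<and> c \<le> 2 * 2 ^ n * sine_cost (n + 2) + 16 * (2 ^ n * 2 ^ n)"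
      using mat_chain_V_full_transpose by (intro exI conjI) auto
    show "\<exists>c. mat_chain (normalize_cols (U_full n m)) c \<and> c \<le> 2 * 2 ^ n * sine_cost (n + 2) + 16 * (2 ^ n * 2 ^ n)"
      using mat_chain_normalize_cols[OF mat_chain_U_full] dims E by (intro exI conjI) auto
    show "\<exists>c. mat_chain (col_norms (U_full n m) * Sigma_full n m) c \<and> c \<le> 2 * 2 ^ n * sine_cost (n + 2) + 16 * (2 ^ n * 2 ^ n)"
      using mat_chain_scaled_Sigma E by (intro exI conjI) auto
  qed
  ultimately show ?thesis using program_of_mat_chain assms(1) by blast
qed

end
section \<open>The theorem\<close>

theorem theorem3p5:
  shows "(\<forall>n m :: nat. 2 \<le> n \<and> m \<in> {2..n} \<longrightarrow>
            S_full n m = U_full n m * Sigma_full n m * transpose_mat (V_full n m) \<and>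
            is_svd (S_full n m)
              (normalize_cols (U_full n m)) (col_norms (U_full n m) * Sigma_full n m) (V_full n m))
         \<and>
         (\<exists>C :: real. \<forall>n m :: nat. 2 \<le> n \<and> m \<in> {2..n} \<longrightarrow>
            (\<forall>M \<in> {U_full n m, Sigma_full n m, V_full n m, transpose_mat (V_full n m),
                    normalize_cols (U_full n m), col_norms (U_full n m) * Sigma_full n m}.
               \<exists>p. computes p M \<and>
                 real (length p) \<le> C * (2 ^ n) ^ 2 * log 2 (2 ^ n)))"
proof (intro conjI exI[of _ 1840] allI impI ballI)
  fix n m :: nat
  assume "2 \<le> n \<and> m \<in> {2..n}"
  then have n: "2 \<le> n" and m: "0 < m" "m \<le> n" by auto
  show "S_full n m = U_full n m * Sigma_full n m * transpose_mat (V_full n m)"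
    by (rule S_full_factorization[OF m])
  show "is_svd (S_full n m)
      (normalize_cols (U_full n m)) (col_norms (U_full n m) * Sigma_full n m) (V_full n m)"
    by (rule S_full_svd[OF m])
  fix M assume "M \<in> {U_full n m, Sigma_full n m, V_full n m, transpose_mat (V_full n m),
      normalize_cols (U_full n m), col_norms (U_full n m) * Sigma_full n m}"
  then show "\<exists>p. computes p M \<and> real (length p) \<le> 1840 * (2 ^ n) ^ 2 * log 2 (2 ^ n)"
    by (rule full_programs[OF m n])
qed

end
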